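(* For each integer $n\ge 2$, among all $n$-dimensional box domains $[0,q_1]\times\cdots\times[0,q_n]$ with $q_1,\dots,q_n>0$ and volume $\prod_{j=1}^n q_j$ equal to one, the zeta regularized determinant of the Laplacian with the Neumann boundary condition is uniquely maximized by the equilateral box with side lengths equal to one, i.e. $q_1=\cdots=q_n=1$.
   Context: The eigenvalues of the (nonnegative) Laplacian with Neumann boundary condition on $[0,q_1]\times\cdots\times[0,q_n]$, counted with multiplicity, are $\pi^2\sum_{j=1}^n k_j^2/q_j^2$ with $k=(k_1,\dots,k_n)$ ranging over all $n$-tuples of nonnegative integers. The Neumann spectral zeta function is $\zeta_{\diamondsuit}(s)=\sum_{k\neq 0}\left(\pi^2\sum_{j=1}^n k_j^2/q_j^2\right)^{-s}$ for $\operatorname{Re}(s)>n/2$, the sum running over nonzero tuples of nonnegative integers. It extends meromorphically to $\mathbb{C}$ and is holomorphic near $s=0$. The zeta regularized determinant is $e^{-\zeta_{\diamondsuit}'(0)}$, where $\zeta_{\diamondsuit}'(0)$ is computed from this continuation. *)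

theory Defs
  imports "HOL-Complex_Analysis.Complex_Analysis"
begin

text \<open>
  A vector \<open>q\<close> with positive entries stands for the box \<open>[0,q\<^sub>1] \<times> \<dots> \<times> [0,q\<^sub>n]\<close>, where
  \<open>n = CARD('n)\<close>. The Neumann eigenvalues are indexed, with multiplicity, by
  \<open>k :: nat ^ 'n\<close>, the index \<open>k = 0\<close> belonging to the constant functions.
\<close>

definition neumann_eigenvalue :: "real ^ 'n \<Rightarrow> nat ^ 'n \<Rightarrow> real" where
  "neumann_eigenvalue q k = pi\<^sup>2 * (\<Sum>j\<in>UNIV. (real (k $ j))\<^sup>2 / (q $ j)\<^sup>2)"

definition neumann_zeta_series :: "real ^ 'n \<Rightarrow> complex \<Rightarrow> complex" where
  "neumann_zeta_series q s =
     (\<Sum>\<^sub>\<infinity>k\<in>{k. k \<noteq> 0}. complex_of_real (neumann_eigenvalue q k) powr (- s))"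

text \<open>
  The meromorphic continuation. Plain \<^term>\<open>Z meromorphic_on UNIV\<close> leaves the values of
  \<open>Z\<close> on a discrete set arbitrary; \<open>nicely_meromorphic_on\<close> removes that freedom (removable
  singularities are filled in and poles get the value 0), so that the continuation is
  unique as a function and holomorphic wherever it has no pole.
\<close>

definition neumann_zeta :: "real ^ 'n \<Rightarrow> complex \<Rightarrow> complex" where
  "neumann_zeta q = (THE Z. Z nicely_meromorphic_on UNIV \<and>
     (\<forall>s. Re s > real CARD('n) / 2 \<longrightarrow> Z s = neumann_zeta_series q s))"

text \<open>
  The eigenvalues are real, so the zeta function is real on the real axis and the number
  \<open>exp (- \<zeta>'(0))\<close> is real; \<^const>\<open>Re\<close> only changes its type.
\<close>

definition neumann_det :: "real ^ 'n \<Rightarrow> real" where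
  "neumann_det q = Re (exp (- deriv (neumann_zeta q) 0))"

definition unit_volume_box :: "real ^ 'n \<Rightarrow> bool" where
  "unit_volume_box q \<longleftrightarrow> (\<forall>j. q $ j > 0) \<and> (\<Prod>j\<in>UNIV. q $ j) = 1"

end

theory Submission
  imports Defs "HOL-Real_Asymp.Real_Asymp"
begin

text \<open>
  Write \<open>\<theta>(x) = \<Sum>\<^sub>k exp (- \<pi> k\<^sup>2 x)\<close> over the integers \<open>k\<close>. Since the sum over the natural numbers is
  \<open>(1 + \<theta>) / 2\<close>, the Neumann heat trace is \<open>2\<^sup>-\<^sup>n\<close> times a sum over the sets \<open>S\<close> of coordinates of
  the heat traces of the flat rectangular tori spanned by \<open>S\<close>. Rescale the torus of \<open>S\<close>, of
  dimension \<open>d\<close>, to volume one; its trace becomes \<open>P x = \<Prod>\<^sub>S \<theta>(c\<^sub>j x)\<close> with \<open>\<Prod>\<^sub>S c\<^sub>j = 1\<close>. Splitting the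
  Mellin integral at \<open>x = 1\<close> and using \<open>\<theta>(1/x) = \<surd>x \<theta>(x)\<close> gives the continuation and a formula for
  \<open>\<zeta>'(0)\<close>: up to a constant depending on \<open>n\<close> only, and up to the scaling terms, which cancel in the
  sum over \<open>S\<close> because the box has volume one, it is \<open>2\<^sup>-\<^sup>n\<close> times the sum over \<open>S\<close> of
  \<open>\<integral>\<^sub>1\<^sup>\<infinity> (\<Prod>\<^sub>S \<theta>(c\<^sub>j x) - 1) dx/x + \<integral>\<^sub>1\<^sup>\<infinity> (\<Prod>\<^sub>S \<theta>(x/c\<^sub>j) - 1) x\<^sup>d\<^sup>/\<^sup>2 dx/x\<close>.
  As \<open>u \<mapsto> ln \<theta>(exp u)\<close> is strictly convex, both integrands are pointwise minimal exactly when all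
  \<open>c\<^sub>j\<close> are one. So \<open>\<zeta>'(0)\<close> is minimal, and the determinant maximal, exactly for the cube.
\<close>

subsection \<open>The functional equation of the theta function\<close>

text \<open>Convexity is hard to read off the theta series near \<open>x = 0\<close>, where many
  terms matter. The functional equation removes that region: with \<open>u / 4\<close> added, the
  logarithm becomes even in \<open>u\<close>, so its slope has to be controlled only for
  \<open>x\<close> at least one, where crude bounds on the series suffice. The functional equation
  thus serves twice, for the continuation and for the convexity.

  The formula for the derivative at 0 contains values of integrals and none of their derivatives
  because the reciprocal Gamma function has a simple zero there. The two integrals belong to a torus
  and to its dual. The scale factors of both have product one and the weights are positive, so one
  Jensen inequality settles both.

  Uniqueness rests on the set \<open>S\<close> of all coordinates. Smaller sets can be blind to the
  shape: for a singleton the normalized torus is always the same circle.\<close>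

lemma sum_cis_roots_of_unity:
  assumes "l > 0"
  shows "(\<Sum>\<nu><l. cis (2 * pi * of_int j * real \<nu> / real l)) = (if int l dvd j then of_nat l else 0)"
proof -
  define z where "z = cis (2 * pi * of_int j / real l)"
  have eq: "cis (2 * pi * of_int j * real \<nu> / real l) = z ^ \<nu>" for \<nu>
    unfolding z_def Complex.DeMoivre by (intro arg_cong[of _ _ cis]) (simp add: field_simps)
  have zl: "z ^ l = 1"
    using assms cis_multiple_2pi[of "of_int j"] unfolding z_def Complex.DeMoivre by simp
  have z1: "z = 1 \<longleftrightarrow> int l dvd j"
  proof
    assume "z = 1"
    then obtain k :: int where "2 * pi * of_int j / real l = 2 * pi * of_int k"
      unfolding z_def cis_conv_exp exp_eq_1 by (auto simp: mult_ac)
    hence "real_of_int j = of_int (k * int l)"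
      using assms by (simp add: field_simps)
    hence "j = k * int l" by (simp only: of_int_eq_iff)
    thus "int l dvd j" by simp
  next
    assume "int l dvd j"
    then obtain k where "j = int l * k" by blast
    hence "2 * pi * of_int j / real l = 2 * pi * of_int k"
      using assms by simp
    thus "z = 1" unfolding z_def by (simp only: cis_multiple_2pi Ints_of_int)
  qed
  have "(\<Sum>\<nu><l. z ^ \<nu>) = (if z = 1 then of_nat l else 0)"
    using zl by (auto simp: geometric_sum)
  with z1 show ?thesis by (simp add: eq)
qed

lemma cos_power_expansion:
  "of_real ((2 * cos y) ^ (2 * m)) =
    (\<Sum>i\<le>2*m. of_nat ((2*m) choose i) * cis (2 * (real i - real m) * y))"
proof -
  have "of_real (2 * cos y) = cis y + cis (- y)"
    by (simp add: complex_eq_iff)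
  hence "of_real ((2 * cos y) ^ (2 * m)) = (cis y + cis (- y)) ^ (2 * m)"
    by (simp only: of_real_power)
  also have "\<dots> = (\<Sum>i\<le>2*m. of_nat ((2*m) choose i) * cis y ^ i * cis (- y) ^ (2 * m - i))"
    by (rule binomial_ring)
  also have "\<dots> = (\<Sum>i\<le>2*m. of_nat ((2*m) choose i) * cis (2 * (real i - real m) * y))"
    by (intro sum.cong refl)
       (simp add: Complex.DeMoivre mult.assoc cis_mult of_nat_diff algebra_simps)
  finally show ?thesis .
qed

text \<open>Averaging the binomial expansion over the \<open>l\<close> equidistant angles acts as a
  roots-of-unity filter: only the frequencies \<open>i - m\<close> divisible by \<open>l\<close>
  survive.\<close>

lemma sum_cos_power:
  assumes "l > 0"
  shows "(\<Sum>\<nu><l. (2 * cos (pi * real \<nu> / real l)) ^ (2 * m)) =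
    real l * (\<Sum>i | i \<le> 2 * m \<and> int l dvd int i - int m. real ((2*m) choose i))"
proof -
  have "complex_of_real (\<Sum>\<nu><l. (2 * cos (pi * real \<nu> / real l)) ^ (2 * m)) =
      (\<Sum>\<nu><l. \<Sum>i\<le>2*m. of_nat ((2*m) choose i) * cis (2 * (real i - real m) * (pi * real \<nu> / real l)))"
    by (simp only: of_real_sum cos_power_expansion)
  also have "\<dots> = (\<Sum>i\<le>2*m. of_nat ((2*m) choose i) *
      (\<Sum>\<nu><l. cis (2 * pi * of_int (int i - int m) * real \<nu> / real l)))"
    by (subst sum.swap) (simp add: sum_distrib_left mult_ac)
  also have "\<dots> = (\<Sum>i\<le>2*m. if int l dvd int i - int m then of_nat l * of_nat ((2*m) choose i) else 0)"
    by (subst sum_cis_roots_of_unity[OF assms]) (auto intro!: sum.cong)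
  also have "\<dots> = (\<Sum>i | i \<le> 2 * m \<and> int l dvd int i - int m. of_nat l * of_nat ((2*m) choose i))"
    by (simp add: sum.inter_filter[symmetric])
  also have "\<dots> = complex_of_real (real l * (\<Sum>i | i \<le> 2 * m \<and> int l dvd int i - int m. real ((2*m) choose i)))"
    by (simp add: sum_distrib_left)
  finally show ?thesis by (simp only: of_real_eq_iff)
qed

text \<open>The residue class is symmetric about \<open>m\<close>, and so are the binomial
  coefficients. The tail is written as an infinite series, although almost all of its terms vanish,
  because Tannery's theorem is later applied to it.\<close>

lemma sum_binomial_residue:
  assumes "l > 0"
  shows "(\<Sum>i | i \<le> 2 * m \<and> int l dvd int i - int m. real ((2*m) choose i)) =
    real ((2*m) choose m) + 2 * (\<Sum>k. real ((2*m) choose (m + Suc k * l)))"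
proof -
  define f where "f i = real ((2*m) choose i)" for i
  define K where "K = {k. Suc k * l \<le> m}"
  have finK: "finite K"
  proof (rule finite_subset)
    show "K \<subseteq> {..m}" using assms unfolding K_def
      by (cases l) auto
  qed simp
  have inj1: "inj_on (\<lambda>k. m + Suc k * l) K" using assms by (auto simp: inj_on_def)
  have inj2: "inj_on (\<lambda>k. m - Suc k * l) K"
  proof (rule inj_onI)
    fix x y assume "x \<in> K" "y \<in> K" "m - Suc x * l = m - Suc y * l"
    hence "Suc x * l = Suc y * l" unfolding K_def mem_Collect_eq by (metis diff_diff_cancel)
    thus "x = y" using assms by simp
  qed
  have set: "{i. i \<le> 2 * m \<and> int l dvd int i - int m} =
     insert m ((\<lambda>k. m + Suc k * l) ` K \<union> (\<lambda>k. m - Suc k * l) ` K)" (is "?A = ?B")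
  proof
    show "?B \<subseteq> ?A" using assms by (auto simp: K_def of_nat_diff simp del: mult_Suc)
    show "?A \<subseteq> ?B"
    proof
      fix i assume i: "i \<in> ?A"
      then obtain k where k: "int i - int m = int l * k" by (auto elim: dvdE)
      consider "k = 0" | "k > 0" | "k < 0" by linarith
      thus "i \<in> ?B"
      proof cases
        case 1 thus ?thesis using k by simp
      next
        case 2
        then obtain n where n: "k = int (Suc n)" by (metis gr0_implies_Suc pos_int_cases)
        have "int i = int (m + Suc n * l)" using k n by (simp add: algebra_simps)
        hence e: "i = m + Suc n * l" by (simp only: of_nat_eq_iff)
        hence "n \<in> K" using i by (simp add: K_def)
        thus ?thesis using e by blast
      next
        case 3
        then obtain n where n: "k = - int (Suc n)" by (metis neg_int_cases gr0_implies_Suc)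
        have "int i + int (Suc n * l) = int m" using k n by (simp add: algebra_simps)
        hence e: "i + Suc n * l = m" by (simp only: of_nat_eq_iff flip: of_nat_add)
        hence "n \<in> K" by (simp add: K_def)
        moreover have "i = m - Suc n * l" using e by simp
        ultimately show ?thesis by blast
      qed
    qed
  qed
  have disj: "(\<lambda>k. m + Suc k * l) ` K \<inter> (\<lambda>k. m - Suc k * l) ` K = {}"
    using assms by (auto simp: K_def)
  have nm: "m \<notin> (\<lambda>k. m + Suc k * l) ` K \<union> (\<lambda>k. m - Suc k * l) ` K"
    using assms by (auto simp: K_def)
  have "sum f ?A = f m + ((\<Sum>k\<in>K. f (m + Suc k * l)) + (\<Sum>k\<in>K. f (m - Suc k * l)))"
    unfolding set using finK nm disj inj1 inj2
    by (simp add: sum.union_disjoint sum.reindex o_def del: mult_Suc)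
  also have "(\<Sum>k\<in>K. f (m - Suc k * l)) = (\<Sum>k\<in>K. f (m + Suc k * l))"
  proof (rule sum.cong)
    fix k assume "k \<in> K"
    hence "Suc k * l \<le> m" by (simp add: K_def)
    thus "f (m - Suc k * l) = f (m + Suc k * l)" unfolding f_def
      by (subst binomial_symmetric) (auto intro!: arg_cong[of _ _ "\<lambda>x. real (_ choose x)"])
  qed simp
  also have "(\<Sum>k\<in>K. f (m + Suc k * l)) = (\<Sum>k. f (m + Suc k * l))"
    by (rule suminf_finite[symmetric, OF finK]) (simp add: K_def f_def del: mult_Suc)
  finally show ?thesis by (simp add: f_def)
qed

text \<open>The reflection of \<open>\<nu>\<close> to \<open>2*r+1-\<nu>\<close> pairs the nonzero
  indices without a fixed point because the modulus is odd. The representatives kept have angles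
  below \<open>pi / 2\<close>, where \<open>cos_le_exp\<close> applies.\<close>

lemma sum_cos_power_symmetric:
  "(\<Sum>\<nu><2*r+1. (2 * cos (pi * real \<nu> / real (2*r+1))) ^ (2 * m)) =
     4 ^ m * (1 + 2 * (\<Sum>\<nu><r. cos (pi * real (Suc \<nu>) / real (2*r+1)) ^ (2 * m)))"
proof -
  define f where "f \<nu> = cos (pi * real \<nu> / real (2*r+1)) ^ (2 * m)" for \<nu>
  have refl: "f (2*r+1-\<nu>) = f \<nu>" if "\<nu> \<le> 2*r+1" for \<nu>
  proof -
    have "pi * real (2*r+1-\<nu>) / real (2*r+1) = pi - pi * real \<nu> / real (2*r+1)"
      using that by (simp add: of_nat_diff field_simps)
    thus ?thesis unfolding f_def by (simp add: power_mult)
  qed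
  have "(\<Sum>\<nu><2*r+1. (2 * cos (pi * real \<nu> / real (2*r+1))) ^ (2 * m)) = 4 ^ m * (\<Sum>\<nu><2*r+1. f \<nu>)"
    unfolding f_def sum_distrib_left by (intro sum.cong) (simp_all add: power_mult_distrib power_mult)
  also have "sum f {..<2*r+1} = sum f (insert 0 ({1..r} \<union> {r+1..2*r}))"
    by (rule arg_cong[of _ _ "sum f"]) auto
  also have "\<dots> = f 0 + (sum f {1..r} + sum f {r+1..2*r})"
    by (subst sum.insert) (auto intro!: sum.union_disjoint)
  also have "sum f {r+1..2*r} = sum f {1..r}"
    by (rule sum.reindex_bij_witness[of _ "\<lambda>i. 2*r+1-i" "\<lambda>i. 2*r+1-i"])
       (use refl in auto)
  also have "sum f {1..r} = (\<Sum>\<nu><r. f (Suc \<nu>))"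
    by (rule sum.reindex_bij_witness[of _ Suc "\<lambda>i. i - 1"]) auto
  finally show ?thesis by (simp add: f_def del: sum.lessThan_Suc)
qed

section \<open>Gaussian bounds for cosines and binomial ratios\<close>

lemma cos_le_exp:
  assumes "0 \<le> y" "y \<le> pi / 2"
  shows "cos y \<le> exp (- y\<^sup>2 / 2)"
proof -
  \<comment> \<open>The derivative of this product has the sign of \<open>x * cos x - sin x\<close>,
    which starts at 0 and has derivative \<open>- (x * sin x)\<close>.\<close>
  have "exp (y\<^sup>2 / 2) * cos y \<le> exp (0\<^sup>2 / 2) * cos 0"
  proof (rule DERIV_nonpos_imp_nonincreasing[OF assms(1)])
    fix x assume x: "0 \<le> x" "x \<le> y"
    have "x * cos x \<le> sin x"
    proof -
      have "0 * cos 0 - sin 0 \<ge> x * cos x - sin x"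
      proof (rule DERIV_nonpos_imp_nonincreasing[OF x(1)])
        fix t assume t: "0 \<le> t" "t \<le> x"
        have "((\<lambda>x. x * cos x - sin x) has_real_derivative - (t * sin t)) (at t)"
          by (auto intro!: derivative_eq_intros)
        moreover have "sin t \<ge> 0" using t x assms by (intro sin_ge_zero) auto
        ultimately show "\<exists>y. ((\<lambda>x. x * cos x - sin x) has_real_derivative y) (at t) \<and> y \<le> 0"
          using t by (intro exI[of _ "- (t * sin t)"]) auto
      qed
      thus ?thesis by simp
    qed
    moreover have "((\<lambda>y. exp (y\<^sup>2 / 2) * cos y) has_real_derivative exp (x\<^sup>2/2) * (x * cos x - sin x)) (at x)"
      by (auto intro!: derivative_eq_intros simp: algebra_simps)
    ultimately show "\<exists>d. ((\<lambda>y. exp (y\<^sup>2 / 2) * cos y) has_real_derivative d) (at x) \<and> d \<le> 0"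
      by (intro exI[of _ "exp (x\<^sup>2/2) * (x * cos x - sin x)"] conjI mult_nonneg_nonpos) auto
  qed
  thus ?thesis by (simp add: exp_minus field_simps)
qed

text \<open>With the ratio written as \<open>j\<close> factors close to 1, the inequality between
  \<open>1 + t\<close> and \<open>exp t\<close>, applied factor by factor, yields Gaussian bounds on
  both sides without Stirling's formula.\<close>

lemma binomial_ratio_prod:
  assumes "j \<le> m"
  shows "real ((2*m) choose (m + j)) / real ((2*m) choose m) = (\<Prod>i=1..j. 1 - real j / real (m + i))"
proof -
  have a: "real ((2*m) choose (m + j)) = fact (2*m) / (fact (m+j) * fact (m-j))"
    using assms by (subst binomial_fact) (auto simp: mult_2)
  have b: "real ((2*m) choose m) = fact (2*m) / (fact m * fact m)"
    by (subst binomial_fact) (auto simp: mult_2)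
  have c: "fact (p + k) = (fact p * (\<Prod>i=1..k. real (p + i)) :: real)" for p k :: nat
    by (induction k) (simp_all add: mult_ac add_ac)
  have d: "fact m = (fact (m - j) * (\<Prod>i=1..j. real (m + i - j)) :: real)"
  proof -
    have "fact ((m - j) + j) = (fact (m - j) * (\<Prod>i=1..j. real ((m - j) + i)) :: real)"
      by (rule c)
    thus ?thesis using assms by simp
  qed
  have "real ((2*m) choose (m + j)) / real ((2*m) choose m) = fact m * fact m / (fact (m+j) * fact (m-j))"
    by (simp add: a b)
  also have "\<dots> = (\<Prod>i=1..j. real (m + i - j)) / (\<Prod>i=1..j. real (m + i))"
    unfolding c by (subst d) simp
  also have "\<dots> = (\<Prod>i=1..j. 1 - real j / real (m + i))"
    using assms by (subst prod_dividef[symmetric]) (auto intro!: prod.cong simp: of_nat_diff field_simps)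
  finally show ?thesis .
qed

definition jtheta :: "real \<Rightarrow> real" where
  "jtheta x = 1 + 2 * (\<Sum>k. exp (- (pi * (real (Suc k))\<^sup>2 * x)))"

lemma binomial_ratio_upper:
  assumes "j \<le> m" "0 < m"
  shows "real ((2*m) choose (m + j)) / real ((2*m) choose m) \<le> exp (- ((real j)\<^sup>2 / real (m + j)))"
proof -
  have "(\<Prod>i=1..j. 1 - real j / real (m + i)) \<le> (\<Prod>i=1..j. exp (- (real j / real (m + j))))"
  proof (rule prod_mono, safe)
    fix i assume i: "i \<in> {1..j}"
    show "0 \<le> 1 - real j / real (m + i)" using i assms by (simp add: field_simps)
    have "1 - real j / real (m + i) \<le> 1 + (- (real j / real (m + j)))"
      using i assms by (simp add: frac_le)
    also have "\<dots> \<le> exp (- (real j / real (m + j)))" by (rule exp_ge_add_one_self)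
    finally show "1 - real j / real (m + i) \<le> exp (- (real j / real (m + j)))" .
  qed
  also have "\<dots> = exp (- ((real j)\<^sup>2 / real (m + j)))"
    by (simp add: power2_eq_square flip: exp_of_nat_mult)
  finally show ?thesis by (simp add: binomial_ratio_prod[OF assms(1)])
qed

text \<open>Each factor \<open>1 - j / (m + i)\<close> is the reciprocal of \<open>1 + t\<close>
  with \<open>t = j / (m + i - j)\<close>, so the upper bound \<open>exp t\<close> for
  \<open>1 + t\<close> becomes a lower bound for the factor.\<close>

lemma binomial_ratio_lower:
  assumes "j < m"
  shows "exp (- ((real j)\<^sup>2 / real (m - j))) \<le> real ((2*m) choose (m + j)) / real ((2*m) choose m)"
proof -
  have "exp (- ((real j)\<^sup>2 / real (m - j))) = (\<Prod>i=1..j. exp (- (real j / real (m - j))))"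
    by (simp add: power2_eq_square flip: exp_of_nat_mult)
  also have "\<dots> \<le> (\<Prod>i=1..j. 1 - real j / real (m + i))"
  proof (rule prod_mono, safe)
    fix i assume i: "i \<in> {1..j}"
    have pos: "real (m + i) - real j > 0" using assms by simp
    have "1 + real j / (real (m + i) - real j) \<le> exp (real j / (real (m + i) - real j))"
      by (rule exp_ge_add_one_self)
    also have "\<dots> \<le> exp (real j / real (m - j))"
      using assms i by (simp add: of_nat_diff frac_le)
    finally have le: "1 + real j / (real (m + i) - real j) \<le> exp (real j / real (m - j))" .
    have "exp (- (real j / real (m - j))) \<le> 1 / (1 + real j / (real (m + i) - real j))"
      unfolding exp_minus inverse_eq_divide using le pos
      by (intro divide_left_mono mult_pos_pos) (auto intro: add_pos_nonneg)
    also have "\<dots> = 1 - real j / real (m + i)" using pos by (simp add: field_simps)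
    finally show "exp (- (real j / real (m - j))) \<le> 1 - real j / real (m + i)" .
  qed auto
  also have "\<dots> = real ((2*m) choose (m + j)) / real ((2*m) choose m)"
    using assms by (simp add: binomial_ratio_prod)
  finally show ?thesis .
qed

text \<open>This is Wallis' product: with \<open>t = 2 * m + 1\<close> consecutive terms have the
  ratio \<open>t * (t + 2) / (t + 1)^2\<close>, which is below 1. Monotonicity alone gives a limit;
  its value \<open>2 / pi\<close> falls out of \<open>jtheta_inverse\<close>.\<close>

lemma central_binomial_limit:
  obtains L where "(\<lambda>m. ((real ((2*m) choose m)) / 4 ^ m)\<^sup>2 * (2 * real m + 1)) \<longlonglongrightarrow> L"
proof -
  define E where "E m = ((real ((2*m) choose m)) / 4 ^ m)\<^sup>2 * (2 * real m + 1)" for m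
  have step: "real ((2 * Suc m) choose (Suc m)) / 4 ^ Suc m =
      real ((2*m) choose m) / 4 ^ m * ((2 * real m + 1) / (2 * real m + 2))" for m
  proof -
    define a where "a = real m + 1"
    have a: "a > 0" by (simp add: a_def)
    have "real ((2 * Suc m) choose (Suc m)) = fact (2 * Suc m) / (fact (Suc m) * fact (Suc m))"
      by (subst binomial_fact) auto
    also have "fact (2 * Suc m) = (2 * a) * ((2 * real m + 1) * fact (2 * m))"
      by (simp add: a_def algebra_simps)
    also have "fact (Suc m) = a * fact m" by (simp add: a_def algebra_simps)
    finally have C: "real ((2 * Suc m) choose (Suc m)) =
      (2 * a) * ((2 * real m + 1) * fact (2 * m)) / ((a * fact m) * (a * fact m))" .
    have D: "real ((2*m) choose m) = fact (2*m) / (fact m * fact m)"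
      by (subst binomial_fact) (auto simp: mult_2)
    have "2 * real m + 2 = 2 * a" by (simp add: a_def)
    with a show ?thesis unfolding C D by (simp add: divide_simps)
  qed
  have "E (Suc m) \<le> E m" for m
  proof -
    have "E (Suc m) = (real ((2*m) choose m) / 4 ^ m)\<^sup>2 * (((2 * real m + 1) / (2 * real m + 2))\<^sup>2 * (2 * real m + 3))"
      unfolding E_def step by (simp only: power_mult_distrib mult.assoc) simp
    also have "\<dots> \<le> (real ((2*m) choose m) / 4 ^ m)\<^sup>2 * (2 * real m + 1)"
    proof (rule mult_left_mono)
      define t where "t = 2 * real m + 1"
      have t: "t > 0" by (simp add: t_def add_nonneg_pos)
      hence "t\<^sup>2 * (t + 2) \<le> t * (t + 1)\<^sup>2" by (simp add: power2_eq_square algebra_simps)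
      hence "(t / (t + 1))\<^sup>2 * (t + 2) \<le> t" using t by (simp add: power_divide pos_divide_le_eq)
      thus "((2 * real m + 1) / (2 * real m + 2))\<^sup>2 * (2 * real m + 3) \<le> 2 * real m + 1"
        by (simp add: t_def add_ac)
    qed simp
    finally show ?thesis by (simp add: E_def)
  qed
  hence "decseq E" by (rule decseq_SucI)
  moreover have "0 \<le> E m" for m by (simp add: E_def)
  ultimately obtain L where "E \<longlonglongrightarrow> L" using decseq_convergent[of E 0] by blast
  thus ?thesis using that unfolding E_def by blast
qed

lemma summable_exp_square:
  assumes "a > 0"
  shows "summable (\<lambda>k. exp (- ((real (Suc k))\<^sup>2 * a)))"
proof (rule summable_comparison_test')
  show "summable (\<lambda>k. exp (- a) ^ k)" using assms by (simp add: summable_geometric)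
  fix k :: nat assume "k \<ge> 0"
  have "real k \<le> (real (Suc k))\<^sup>2" by (simp add: power2_eq_square algebra_simps)
  hence "real k * a \<le> (real (Suc k))\<^sup>2 * a" using assms by simp
  thus "norm (exp (- ((real (Suc k))\<^sup>2 * a))) \<le> exp (- a) ^ k"
    by (simp flip: exp_of_nat_mult)
qed

lemma summable_jtheta: "x > 0 \<Longrightarrow> summable (\<lambda>k. exp (- (pi * (real (Suc k))\<^sup>2 * x)))"
  using summable_exp_square[of "pi * x"] by (simp add: mult_ac)

lemma jtheta_pos: "x > 0 \<Longrightarrow> jtheta x > 0"
  unfolding jtheta_def by (intro add_pos_nonneg mult_nonneg_nonneg suminf_nonneg summable_jtheta) auto

text \<open>
  Polya's argument: \<open>sum_cos_power\<close> equates a binomial sum over a residue class modulo \<open>l\<close> with a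
  sum of powers of cosines. With \<open>m \<approx> \<tau> l\<^sup>2\<close> and \<open>l \<rightarrow> \<infinity>\<close> both sides become theta series. The constant
  \<open>L\<close> in the limit need not be known in advance, as \<open>x = 1\<close> determines it.
\<close>

theorem jtheta_inverse:
  assumes "x > 0"
  shows "jtheta (1 / x) = sqrt x * jtheta x"
proof -
  obtain L where L: "(\<lambda>m. ((real ((2*m) choose m)) / 4 ^ m)\<^sup>2 * (2 * real m + 1)) \<longlonglongrightarrow> L"
    by (rule central_binomial_limit)
  \<comment> \<open>The identity is squared to match \<open>central_binomial_limit\<close>;
    positivity of \<open>jtheta\<close> allows the root to be taken at the end.\<close>
  have main: "(jtheta (pi * \<tau>))\<^sup>2 = L / (2 * \<tau>) * (jtheta (1 / (pi * \<tau>)))\<^sup>2" if \<tau>: "\<tau> > 0" for \<tau>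
  proof -
    \<comment> \<open>Odd, as the folding of the cosine sum requires. In the next line
      \<open>m\<close> is rounded up, so that \<open>m \<ge> \<tau> * l^2\<close>, which is the
      direction the majorant of \<open>b\<close> needs.\<close>
    define l where "l r = 2 * r + 1" for r :: nat
    define m where "m r = nat \<lceil>\<tau> * (real (l r))\<^sup>2\<rceil>" for r
    have l1: "real (l r) \<ge> 1" for r by (simp add: l_def)
    have m_real: "real (m r) = of_int \<lceil>\<tau> * (real (l r))\<^sup>2\<rceil>" for r
      using \<tau> unfolding m_def by (intro of_nat_nat) (simp add: less_le_trans[of "-1" 0])
    have m_ge: "\<tau> * (real (l r))\<^sup>2 \<le> real (m r)" for r unfolding m_real by linarith
    have m_le: "real (m r) \<le> \<tau> * (real (l r))\<^sup>2 + 1" for r unfolding m_real by linarith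
    have m_pos: "m r > 0" for r
    proof -
      have "0 < \<tau> * (real (l r))\<^sup>2" using \<tau> l1[of r] by (intro mult_pos_pos) auto
      thus ?thesis using m_ge[of r] by linarith
    qed
    have l_lim: "filterlim (\<lambda>r. real (l r)) at_top sequentially"
      unfolding l_def by real_asymp
    have m_lim: "filterlim m at_top sequentially"
    proof -
      have "filterlim (\<lambda>r. \<tau> * (real (l r))\<^sup>2) at_top sequentially"
        unfolding l_def using \<tau> by real_asymp
      hence "filterlim (\<lambda>r. real (m r)) at_top sequentially"
        by (rule filterlim_at_top_mono) (simp add: m_ge)
      thus ?thesis by (simp add: filterlim_sequentially_iff_filterlim_real)
    qed
    have ml: "(\<lambda>r. real (m r) / (real (l r))\<^sup>2) \<longlonglongrightarrow> \<tau>"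
    proof (rule tendsto_sandwich)
      show "eventually (\<lambda>r. \<tau> \<le> real (m r) / (real (l r))\<^sup>2) sequentially"
        using m_ge l1 by (intro always_eventually allI) (simp add: l_def field_simps)
      show "eventually (\<lambda>r. real (m r) / (real (l r))\<^sup>2 \<le> (\<tau> * (real (l r))\<^sup>2 + 1) / (real (l r))\<^sup>2) sequentially"
        using m_le by (intro always_eventually allI divide_right_mono) auto
      show "(\<lambda>r. (\<tau> * (real (l r))\<^sup>2 + 1) / (real (l r))\<^sup>2) \<longlonglongrightarrow> \<tau>"
        unfolding l_def by real_asymp
    qed auto
    define a where "a k r = real ((2 * m r) choose (m r + Suc k * l r)) / real ((2 * m r) choose m r)" for k r
    \<comment> \<open>Padding by zeros turns a finite sum of growing length into a series, the form
      in which Tannery's theorem takes the limit.\<close>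
    define b where "b k r = (if k < r then cos (pi * real (Suc k) / real (l r)) ^ (2 * m r) else 0)" for k r
    have fin_b: "(\<Sum>k. b k r) = (\<Sum>k<r. cos (pi * real (Suc k) / real (l r)) ^ (2 * m r))" for r
      by (subst suminf_finite[of "{..<r}"]) (auto simp: b_def)
    have identity: "1 + 2 * (\<Sum>k. b k r) =
      real ((2 * m r) choose m r) / 4 ^ m r * real (l r) * (1 + 2 * (\<Sum>k. a k r))" for r
    proof -
      have l0: "l r > 0" by (simp add: l_def)
      have c0: "real ((2 * m r) choose m r) > 0" by simp
      have suma: "(\<Sum>k. real ((2 * m r) choose (m r + Suc k * l r))) =
         real ((2 * m r) choose m r) * (\<Sum>k. a k r)"
      proof -
        have "summable (\<lambda>k. a k r)"
        proof (rule summable_finite[of "{..m r}"])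
          fix k assume "k \<notin> {..m r}"
          hence "m r < Suc k * l r" by (simp add: l_def)
          thus "a k r = 0" by (simp add: a_def del: mult_Suc)
        qed simp
        from suminf_mult[OF this, of "real ((2 * m r) choose m r)"] show ?thesis
          using c0 by (simp add: a_def del: mult_Suc)
      qed
      have "4 ^ m r * (1 + 2 * (\<Sum>k. b k r)) = real (l r) *
          (real ((2 * m r) choose m r) + 2 * (\<Sum>k. real ((2 * m r) choose (m r + Suc k * l r))))"
        using sum_cos_power[OF l0, of "m r"] sum_cos_power_symmetric[of r "m r"]
          sum_binomial_residue[OF l0, of "m r"] unfolding fin_b by (simp only: l_def)
      thus ?thesis unfolding suma by (simp add: field_simps)
    qed
    have lim_a: "(\<lambda>r. \<Sum>k. a k r) \<longlonglongrightarrow> (\<Sum>k. exp (- ((real (Suc k))\<^sup>2 / \<tau>)))"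
    proof -
      \<comment> \<open>For \<open>Suc k * l \<le> m\<close> the denominator satisfies \<open>m +
        Suc k * l \<le> 2 * m \<le> 2 * (\<tau> * l^2 + 1) \<le> 2 * (\<tau> + 1) * l^2\<close>;
        this is the origin of the constant. All other terms vanish.\<close>
      have bound: "norm (a k r) \<le> exp (- ((real (Suc k))\<^sup>2 * (1 / (2 * (\<tau> + 1)))))" for k r
      proof (cases "Suc k * l r \<le> m r")
        case True
        have "(real (Suc k))\<^sup>2 * (1 / (2 * (\<tau> + 1))) = (real (Suc k * l r))\<^sup>2 / (2 * (\<tau> * (real (l r))\<^sup>2 + (real (l r))\<^sup>2))"
        proof -
          define N where "N = (real (l r))\<^sup>2"
          have "N > 0" using l1[of r] by (simp add: N_def)
          moreover have "2 * (\<tau> * N + N) = 2 * (\<tau> + 1) * N" by (simp add: algebra_simps)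
          ultimately show ?thesis unfolding of_nat_mult power_mult_distrib N_def[symmetric]
            by simp
        qed
        also have "\<dots> \<le> (real (Suc k * l r))\<^sup>2 / real (m r + Suc k * l r)"
        proof (rule divide_left_mono)
          have "1\<^sup>2 \<le> (real (l r))\<^sup>2" by (rule power_mono) (use l1 in auto)
          moreover have "real (Suc k * l r) \<le> real (m r)" using True by (simp only: of_nat_le_iff)
          ultimately show "real (m r + Suc k * l r) \<le> 2 * (\<tau> * (real (l r))\<^sup>2 + (real (l r))\<^sup>2)"
            using m_le[of r] unfolding of_nat_add one_power2 distrib_left by linarith
        qed (use m_pos[of r] \<tau> l1[of r] in \<open>auto intro!: mult_pos_pos add_pos_nonneg\<close>)
        finally have "exp (- ((real (Suc k * l r))\<^sup>2 / real (m r + Suc k * l r))) \<le>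
            exp (- ((real (Suc k))\<^sup>2 * (1 / (2 * (\<tau> + 1)))))"
          by (simp only: exp_le_cancel_iff neg_le_iff_le)
        with binomial_ratio_upper[OF True m_pos] have "a k r \<le> exp (- ((real (Suc k))\<^sup>2 * (1 / (2 * (\<tau> + 1)))))"
          unfolding a_def by (rule order_trans)
        moreover have "0 \<le> a k r" by (simp add: a_def)
        ultimately show ?thesis by simp
      next
        case False
        hence "a k r = 0" unfolding a_def by (subst binomial_eq_0) auto
        thus ?thesis by simp
      qed
      have lim: "(\<lambda>r. a k r) \<longlonglongrightarrow> exp (- ((real (Suc k))\<^sup>2 / \<tau>))" for k
      proof (rule tendsto_sandwich)
        have ev: "eventually (\<lambda>r. Suc k * l r < m r) sequentially"
        proof -
          have "eventually (\<lambda>r. real (Suc k) * real (l r) < \<tau> * (real (l r))\<^sup>2) sequentially"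
            unfolding l_def using \<tau> by real_asymp
          thus ?thesis
          proof eventually_elim
            case (elim r)
            hence "real (Suc k * l r) < real (m r)" unfolding of_nat_mult by (rule less_le_trans) (rule m_ge)
            thus ?case by (simp only: of_nat_less_iff)
          qed
        qed
        show "eventually (\<lambda>r. exp (- ((real (Suc k * l r))\<^sup>2 / real (m r - Suc k * l r))) \<le> a k r) sequentially"
          using ev by eventually_elim (unfold a_def, rule binomial_ratio_lower)
        show "eventually (\<lambda>r. a k r \<le> exp (- ((real (Suc k * l r))\<^sup>2 / real (m r + Suc k * l r)))) sequentially"
          using ev by eventually_elim (unfold a_def, rule binomial_ratio_upper, use m_pos in auto)
        have l_lim': "(\<lambda>r. real (Suc k) / real (l r)) \<longlonglongrightarrow> 0"
          unfolding l_def by real_asymp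
        have "(\<lambda>r. exp (- ((real (Suc k))\<^sup>2 / (real (m r) / (real (l r))\<^sup>2 + real (Suc k) / real (l r)))))
           \<longlonglongrightarrow> exp (- ((real (Suc k))\<^sup>2 / (\<tau> + 0)))"
          using \<tau> by (intro tendsto_intros ml l_lim') auto
        moreover have "(real (Suc k))\<^sup>2 / (real (m r) / (real (l r))\<^sup>2 + real (Suc k) / real (l r)) =
            (real (Suc k * l r))\<^sup>2 / real (m r + Suc k * l r)" for r
        proof -
          have "real (m r) / (real (l r))\<^sup>2 + real (Suc k) / real (l r) = real (m r + Suc k * l r) / (real (l r))\<^sup>2"
            using l1[of r] by (simp add: field_simps power2_eq_square)
          thus ?thesis by (simp only: of_nat_mult power_mult_distrib) simp
        qed
        ultimately show "(\<lambda>r. exp (- ((real (Suc k * l r))\<^sup>2 / real (m r + Suc k * l r)))) \<longlonglongrightarrow> exp (- ((real (Suc k))\<^sup>2 / \<tau>))"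
          by simp
        have "(\<lambda>r. exp (- ((real (Suc k))\<^sup>2 / (real (m r) / (real (l r))\<^sup>2 - real (Suc k) / real (l r)))))
           \<longlonglongrightarrow> exp (- ((real (Suc k))\<^sup>2 / (\<tau> - 0)))"
          using \<tau> by (intro tendsto_intros ml l_lim') auto
        moreover have "eventually (\<lambda>r. exp (- ((real (Suc k))\<^sup>2 / (real (m r) / (real (l r))\<^sup>2 - real (Suc k) / real (l r)))) =
            exp (- ((real (Suc k * l r))\<^sup>2 / real (m r - Suc k * l r)))) sequentially"
          using ev
        proof eventually_elim
          case (elim r)
          have "real (m r) / (real (l r))\<^sup>2 - real (Suc k) / real (l r) = real (m r - Suc k * l r) / (real (l r))\<^sup>2"
            using l1[of r] elim by (simp add: of_nat_diff field_simps power2_eq_square)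
          thus ?case by (simp only: of_nat_mult power_mult_distrib) simp
        qed
        ultimately show "(\<lambda>r. exp (- ((real (Suc k * l r))\<^sup>2 / real (m r - Suc k * l r)))) \<longlonglongrightarrow> exp (- ((real (Suc k))\<^sup>2 / \<tau>))"
          by (simp only: tendsto_cong diff_0_right)
      qed
      have "summable (\<lambda>k. exp (- ((real (Suc k))\<^sup>2 * (1 / (2 * (\<tau> + 1))))))"
        using \<tau> by (intro summable_exp_square) auto
      from tannerys_theorem[OF lim always_eventually this] bound show ?thesis by auto
    qed
    have lim_b: "(\<lambda>r. \<Sum>k. b k r) \<longlonglongrightarrow> (\<Sum>k. exp (- ((real (Suc k))\<^sup>2 * (pi\<^sup>2 * \<tau>))))"
    proof -
      have bound: "norm (b k r) \<le> exp (- ((real (Suc k))\<^sup>2 * (pi\<^sup>2 * \<tau>)))" for k r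
      proof (cases "k < r")
        case True
        define y where "y = pi * real (Suc k) / real (l r)"
        have "real (Suc k) / real (l r) \<le> 1 / 2" using True by (simp add: l_def field_simps)
        hence "pi * (real (Suc k) / real (l r)) \<le> pi * (1 / 2)" by (intro mult_left_mono) auto
        hence y: "0 \<le> y" "y \<le> pi / 2" by (simp_all add: y_def)
        have "0 \<le> cos y" using y by (intro cos_ge_zero) auto
        hence "cos y ^ (2 * m r) \<le> exp (- y\<^sup>2 / 2) ^ (2 * m r)"
          by (intro power_mono cos_le_exp y)
        also have "\<dots> = exp (- (real (m r) * y\<^sup>2))" by (simp flip: exp_of_nat_mult)
        also have "\<dots> \<le> exp (- (\<tau> * (real (l r))\<^sup>2 * y\<^sup>2))"
          using m_ge[of r] by (simp add: mult_right_mono)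
        also have "\<tau> * (real (l r))\<^sup>2 * y\<^sup>2 = (real (Suc k))\<^sup>2 * (pi\<^sup>2 * \<tau>)"
          using l1[of r] by (simp add: y_def power_mult_distrib power_divide)
        finally show ?thesis using True \<open>0 \<le> cos y\<close> by (simp add: b_def y_def)
      qed (simp add: b_def)
      have lim: "(\<lambda>r. b k r) \<longlonglongrightarrow> exp (- ((real (Suc k))\<^sup>2 * (pi\<^sup>2 * \<tau>)))" for k
      proof -
        define c where "c = pi * real (Suc k)"
        have c: "c > 0" by (simp add: c_def)
        \<comment> \<open>To leading order \<open>ln (cos t)\<close> is \<open>- t^2 / 2\<close> at
          \<open>t = 0\<close>, here with \<open>t = c / l\<close>.\<close>
        have "(\<lambda>r. (real (l r))\<^sup>2 * ln (cos (c / real (l r)))) \<longlonglongrightarrow> - c\<^sup>2 / 2"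
          unfolding l_def using c by (real_asymp simp: power2_eq_square)
        from tendsto_mult[OF tendsto_mult[OF ml this] tendsto_const[of 2]]
        have "(\<lambda>r. exp (real (m r) / (real (l r))\<^sup>2 * ((real (l r))\<^sup>2 * ln (cos (c / real (l r)))) * 2)) \<longlonglongrightarrow>
            exp (\<tau> * (- c\<^sup>2 / 2) * 2)"
          by (intro tendsto_exp)
        moreover have "eventually (\<lambda>r. cos (c / real (l r)) > 0) sequentially"
          unfolding l_def using c by real_asymp
        hence "eventually (\<lambda>r. exp (real (m r) / (real (l r))\<^sup>2 * ((real (l r))\<^sup>2 * ln (cos (c / real (l r)))) * 2) = b k r) sequentially"
          using eventually_gt_at_top[of k]
        proof eventually_elim
          case (elim r)
          have "b k r = exp (ln (cos (c / real (l r)))) ^ (2 * m r)"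
            using elim by (simp add: b_def c_def)
          also have "\<dots> = exp (real (m r) / (real (l r))\<^sup>2 * ((real (l r))\<^sup>2 * ln (cos (c / real (l r)))) * 2)"
            using l1[of r] by (simp add: mult_ac flip: exp_of_nat_mult)
          finally show ?case ..
        qed
        ultimately have "(\<lambda>r. b k r) \<longlonglongrightarrow> exp (\<tau> * (- c\<^sup>2 / 2) * 2)"
          by (simp only: tendsto_cong)
        also have "\<tau> * (- c\<^sup>2 / 2) * 2 = - ((real (Suc k))\<^sup>2 * (pi\<^sup>2 * \<tau>))"
          by (simp add: c_def power_mult_distrib)
        finally show ?thesis .
      qed
      have "summable (\<lambda>k. exp (- ((real (Suc k))\<^sup>2 * (pi\<^sup>2 * \<tau>))))"
        using \<tau> by (intro summable_exp_square) auto
      from tannerys_theorem[OF lim always_eventually this] bound show ?thesis by auto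
    qed
    have th1: "1 + 2 * (\<Sum>k. exp (- ((real (Suc k))\<^sup>2 / \<tau>))) = jtheta (1 / (pi * \<tau>))"
      by (simp add: jtheta_def)
    have th2: "1 + 2 * (\<Sum>k. exp (- ((real (Suc k))\<^sup>2 * (pi\<^sup>2 * \<tau>)))) = jtheta (pi * \<tau>)"
      by (simp add: jtheta_def power2_eq_square mult_ac)
    have "(\<lambda>r. (1 + 2 * (\<Sum>k. b k r))\<^sup>2) \<longlonglongrightarrow> (jtheta (pi * \<tau>))\<^sup>2"
      unfolding th2[symmetric] by (intro tendsto_intros lim_b)
    moreover have "(\<lambda>r. (1 + 2 * (\<Sum>k. b k r))\<^sup>2) \<longlonglongrightarrow> L * (1 / (2 * \<tau> + 0)) * (jtheta (1 / (pi * \<tau>)))\<^sup>2"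
    proof -
      \<comment> \<open>The factor \<open>l^2\<close> of the squared identity is written as
        \<open>2 * m + 1\<close> times a quotient tending to \<open>1 / (2 * \<tau>)\<close>, so
        that exactly the sequence with limit \<open>L\<close> is split off.\<close>
      have "(\<lambda>r. ((real ((2*m r) choose m r)) / 4 ^ m r)\<^sup>2 * (2 * real (m r) + 1) *
          (1 / (2 * (real (m r) / (real (l r))\<^sup>2) + 1 / (real (l r))\<^sup>2)) * (1 + 2 * (\<Sum>k. a k r))\<^sup>2)
          \<longlonglongrightarrow> L * (1 / (2 * \<tau> + 0)) * (jtheta (1 / (pi * \<tau>)))\<^sup>2"
        unfolding th1[symmetric]
      proof (intro tendsto_intros lim_a ml)
        show "(\<lambda>r. ((real ((2*m r) choose m r)) / 4 ^ m r)\<^sup>2 * (2 * real (m r) + 1)) \<longlonglongrightarrow> L"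
          by (rule filterlim_compose[OF L m_lim])
        show "(\<lambda>r. 1 / (real (l r))\<^sup>2) \<longlonglongrightarrow> 0" unfolding l_def by real_asymp
      qed (use \<tau> in auto)
      moreover have "(1 + 2 * (\<Sum>k. b k r))\<^sup>2 =
         ((real ((2*m r) choose m r)) / 4 ^ m r)\<^sup>2 * (2 * real (m r) + 1) *
          (1 / (2 * (real (m r) / (real (l r))\<^sup>2) + 1 / (real (l r))\<^sup>2)) * (1 + 2 * (\<Sum>k. a k r))\<^sup>2" for r
      proof -
        have "2 * (real (m r) / (real (l r))\<^sup>2) + 1 / (real (l r))\<^sup>2 = (2 * real (m r) + 1) / (real (l r))\<^sup>2"
          by (simp add: add_divide_distrib)
        hence "(2 * real (m r) + 1) * (1 / (2 * (real (m r) / (real (l r))\<^sup>2) + 1 / (real (l r))\<^sup>2)) = (real (l r))\<^sup>2"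
          by (simp add: add_nonneg_eq_0_iff)
        thus ?thesis unfolding identity by (simp only: power_mult_distrib mult.assoc)
      qed
      ultimately show ?thesis by (simp only:)
    qed
    ultimately have "(jtheta (pi * \<tau>))\<^sup>2 = L * (1 / (2 * \<tau> + 0)) * (jtheta (1 / (pi * \<tau>)))\<^sup>2"
      by (rule LIMSEQ_unique)
    thus ?thesis by simp
  qed
  have "(jtheta 1)\<^sup>2 = L / (2 / pi) * (jtheta 1)\<^sup>2"
    using main[of "1 / pi"] by simp
  hence L_eq: "L = 2 / pi" using jtheta_pos[of 1] by (simp add: field_simps)
  have "(jtheta (1 / x))\<^sup>2 = x * (jtheta x)\<^sup>2"
    using main[of "1 / (pi * x)"] assms unfolding L_eq by simp
  hence "sqrt ((jtheta (1 / x))\<^sup>2) = sqrt (x * (jtheta x)\<^sup>2)" by simp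
  thus ?thesis using assms jtheta_pos[of x] jtheta_pos[of "1 / x"] by (simp add: real_sqrt_mult)
qed

subsection \<open>Logarithmic convexity of the theta function\<close>

text \<open>In the variable \<open>y\<close> the derivative is a series of the same kind, with
  coefficients \<open>n * c n\<close> up to sign. General \<open>c\<close> therefore allows an
  induction through all the moments.\<close>

lemma has_derivative_exp_series:
  fixes c :: "nat \<Rightarrow> real"
  assumes c: "\<And>q. norm q < 1 \<Longrightarrow> summable (\<lambda>n. c n * q ^ n)"
  shows "norm q < 1 \<Longrightarrow> summable (\<lambda>n. real n * c n * q ^ n)"
    and "y > 0 \<Longrightarrow> ((\<lambda>y. \<Sum>n. c n * exp (- y) ^ n) has_real_derivative
          - (\<Sum>n. real n * c n * exp (- y) ^ n)) (at y)"
proof -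
  have step: "summable (\<lambda>n. real n * c n * q ^ n) \<and> q * (\<Sum>n. diffs c n * q ^ n) = (\<Sum>n. real n * c n * q ^ n)"
    if q: "norm q < 1" for q
  proof -
    have "summable (\<lambda>n. diffs c n * q ^ n)"
      by (rule termdiff_converges[of _ 1]) (use q c in auto)
    hence s: "summable (\<lambda>n. q * (diffs c n * q ^ n))" by (rule summable_mult)
    have e: "q * (diffs c n * q ^ n) = real (Suc n) * c (Suc n) * q ^ Suc n" for n
      by (simp add: diffs_def)
    have s': "summable (\<lambda>n. real n * c n * q ^ n)"
      using s unfolding e by (subst (asm) summable_Suc_iff)
    have "q * (\<Sum>n. diffs c n * q ^ n) = (\<Sum>n. q * (diffs c n * q ^ n))"
      using \<open>summable (\<lambda>n. diffs c n * q ^ n)\<close> by (rule suminf_mult[symmetric])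
    also have "\<dots> = (\<Sum>n. real n * c n * q ^ n)"
      unfolding e using suminf_split_head[OF s'] by simp
    finally show ?thesis using s' by simp
  qed
  show "norm q < 1 \<Longrightarrow> summable (\<lambda>n. real n * c n * q ^ n)" using step by blast
  assume y: "y > 0"
  hence n: "norm (exp (- y)) < 1" by simp
  have "((\<lambda>x. \<Sum>n. c n * x ^ n) has_real_derivative (\<Sum>n. diffs c n * exp (- y) ^ n)) (at (exp (- y)))"
    by (rule termdiffs_strong'[of 1]) (use c n in auto)
  hence "((\<lambda>y. \<Sum>n. c n * exp (- y) ^ n) has_real_derivative
      (\<Sum>n. diffs c n * exp (- y) ^ n) * - exp (- y)) (at y)"
    by (rule DERIV_chain2) (auto intro!: derivative_eq_intros)
  thus "((\<lambda>y. \<Sum>n. c n * exp (- y) ^ n) has_real_derivative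
          - (\<Sum>n. real n * c n * exp (- y) ^ n)) (at y)"
    using step[OF n] by (simp add: mult.commute)
qed

text \<open>\<open>theta_moment 0\<close> is the theta function as a power series in \<open>exp (- y)\<close> with \<open>y = \<pi> x\<close>.\<close>

definition theta_coeff :: "nat \<Rightarrow> real" where
  "theta_coeff n = (if n = 0 then 1 else if \<exists>k. n = k\<^sup>2 then 2 else 0)"

definition theta_moment :: "nat \<Rightarrow> real \<Rightarrow> real" where
  "theta_moment i y = (\<Sum>n. real n ^ i * theta_coeff n * exp (- y) ^ n)"

lemma summable_theta_coeff:
  "norm q < 1 \<Longrightarrow> summable (\<lambda>n. real n ^ i * theta_coeff n * q ^ n)"
proof (induction i arbitrary: q)
  case 0
  show ?case
  proof (rule summable_comparison_test')
    show "summable (\<lambda>n. 2 * norm q ^ n)" using 0 by (intro summable_mult summable_geometric) auto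
    show "norm (real n ^ 0 * theta_coeff n * q ^ n) \<le> 2 * norm q ^ n" for n
      by (auto simp: theta_coeff_def abs_mult power_abs)
  qed
next
  case (Suc i)
  from has_derivative_exp_series(1)[OF Suc.IH Suc.prems] show ?case by (simp add: mult_ac)
qed

lemma theta_moment_deriv:
  "y > 0 \<Longrightarrow> (theta_moment i has_real_derivative - theta_moment (Suc i) y) (at y)"
  using has_derivative_exp_series(2)[OF summable_theta_coeff, of y i]
  unfolding theta_moment_def by (simp add: mult_ac)

lemma jtheta_conv_moment:
  assumes "x > 0"
  shows "jtheta x = theta_moment 0 (pi * x)"
proof -
  define f where "f n = theta_coeff n * exp (- (pi * x)) ^ n" for n
  have f: "summable f" unfolding f_def using summable_theta_coeff[of "exp (- (pi * x))" 0] assms by simp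
  \<comment> \<open>The constant term is split off first, so the series is indexed by
    \<open>n\<close> with \<open>Suc n\<close> the exponent. Hence the positions of the squares are
    shifted down by one.\<close>
  have sm: "strict_mono (\<lambda>k::nat. (Suc k)\<^sup>2 - 1)"
    by (rule strict_monoI) (simp add: power_strict_mono diff_less_mono)
  have "(\<Sum>k. f (Suc ((Suc k)\<^sup>2 - 1))) = (\<Sum>n. f (Suc n))"
  proof (rule suminf_mono_reindex[OF sm])
    fix n assume n: "n \<notin> range (\<lambda>k::nat. (Suc k)\<^sup>2 - 1)"
    have "\<not> (\<exists>k. Suc n = k\<^sup>2)"
    proof
      assume "\<exists>k. Suc n = k\<^sup>2"
      then obtain k where "Suc n = k\<^sup>2" by blast
      moreover from this have "k = Suc (k - 1)" by (cases k) auto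
      ultimately have "n = (Suc (k - 1))\<^sup>2 - 1" by (metis diff_Suc_1)
      with n show False by blast
    qed
    thus "f (Suc n) = 0" by (simp add: f_def theta_coeff_def)
  qed
  moreover have "f (Suc ((Suc k)\<^sup>2 - 1)) = 2 * exp (- (pi * (real (Suc k))\<^sup>2 * x))" for k
  proof -
    have "Suc ((Suc k)\<^sup>2 - 1) = (Suc k)\<^sup>2" by simp
    thus ?thesis unfolding f_def theta_coeff_def
      by (simp add: mult_ac del: Suc_diff_1 flip: exp_of_nat_mult)
  qed
  moreover have "(\<Sum>k. 2 * exp (- (pi * (real (Suc k))\<^sup>2 * x))) = 2 * (\<Sum>k. exp (- (pi * (real (Suc k))\<^sup>2 * x)))"
  proof (rule suminf_mult)
    show "summable (\<lambda>k. exp (- (pi * (real (Suc k))\<^sup>2 * x)))" by (rule summable_jtheta[OF assms])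
  qed
  moreover have "theta_moment 0 (pi * x) = f 0 + (\<Sum>n. f (Suc n))"
  proof -
    have "theta_moment 0 (pi * x) = suminf f"
      by (simp add: theta_moment_def f_def[abs_def])
    thus ?thesis using suminf_split_head[OF f] by linarith
  qed
  ultimately show ?thesis by (simp add: jtheta_def f_def theta_coeff_def)
qed

text \<open>Replacing every coefficient beyond the constant one by 2 leaves a geometric series. The
  bound is crude but gives a value below 3, hence below \<open>y\<close>, as soon as
  \<open>y \<ge> pi\<close>.\<close>

lemma theta_moment_0_le:
  assumes "y > 0"
  shows "theta_moment 0 y \<le> 1 + 2 / (exp y - 1)"
proof -
  have q: "norm (exp (- y)) < 1" using assms by simp
  have "(\<Sum>n. theta_coeff (Suc n) * exp (- y) ^ Suc n) \<le> (\<Sum>n. 2 * exp (- y) * exp (- y) ^ n)"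
  proof (rule suminf_le)
    show "summable (\<lambda>n. 2 * exp (- y) * exp (- y) ^ n)"
      by (intro summable_mult summable_geometric q)
    show "summable (\<lambda>n. theta_coeff (Suc n) * exp (- y) ^ Suc n)"
      using summable_theta_coeff[OF q, of 0] by (subst summable_Suc_iff) simp
  qed (auto simp: theta_coeff_def)
  also have "\<dots> = 2 * exp (- y) * (1 / (1 - exp (- y)))"
    using q by (subst suminf_mult) (auto simp: suminf_geometric)
  also have "\<dots> = 2 / (exp y - 1)" using assms by (simp add: exp_minus field_simps)
  finally show ?thesis
    using suminf_split_head[of "\<lambda>n. theta_coeff n * exp (- y) ^ n"] summable_theta_coeff[OF q, of 0]
    by (simp add: theta_moment_def theta_coeff_def)
qed

lemma theta_moment_0_ge: "y > 0 \<Longrightarrow> theta_moment 0 y > 1"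
  and theta_moment_pos: "y > 0 \<Longrightarrow> theta_moment i y > 0"
proof -
  assume y: "y > 0"
  have q: "norm (exp (- y)) < 1" using y by simp
  have nn: "0 \<le> real n ^ i * theta_coeff n * exp (- y) ^ n" for n i by (simp add: theta_coeff_def)
  have c1: "theta_coeff 1 = 2" by (auto simp: theta_coeff_def intro: exI[of _ 1])
  show "theta_moment i y > 0"
    unfolding theta_moment_def
    by (rule suminf_pos2[where i = 1, OF summable_theta_coeff[OF q] nn]) (simp add: c1[simplified])
  have "(\<Sum>n\<in>{0,1}. real n ^ 0 * theta_coeff n * exp (- y) ^ n) \<le> theta_moment 0 y"
    unfolding theta_moment_def
    by (rule sum_le_suminf[OF summable_theta_coeff[OF q] _ nn]) auto
  hence "1 + theta_coeff 1 * exp (- y) \<le> theta_moment 0 y" by (simp add: theta_coeff_def[of 0])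
  moreover have "exp (- y) > 0" by simp
  ultimately show "theta_moment 0 y > 1" unfolding c1 by linarith
qed

lemma theta_moment_1_le_2: "y > 0 \<Longrightarrow> theta_moment 1 y \<le> theta_moment 2 y"
  unfolding theta_moment_def
proof (rule suminf_le[OF _ summable_theta_coeff summable_theta_coeff])
  fix n :: nat
  have "real n ^ 1 \<le> real n ^ 2" by (cases n) (auto simp: power2_eq_square)
  thus "real n ^ 1 * theta_coeff n * exp (- y) ^ n \<le> real n ^ 2 * theta_coeff n * exp (- y) ^ n"
    by (intro mult_right_mono) (auto simp: theta_coeff_def)
qed auto

text \<open>The term \<open>n = 0\<close> contributes to neither of the moments 1 and 2, so
  Cauchy-Schwarz may leave it out of the zeroth moment as well. The resulting \<open>- 1\<close> is
  the gain that makes the slope of \<open>log_theta\<close> increase.\<close>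

lemma theta_moment_cauchy_schwarz:
  assumes y: "y > 0"
  shows "(theta_moment 1 y)\<^sup>2 \<le> theta_moment 2 y * (theta_moment 0 y - 1)"
proof -
  define t where "t i n = real n ^ i * theta_coeff n * exp (- y) ^ n" for i n
  have q: "norm (exp (- y)) < 1" using y by simp
  have s: "t i sums theta_moment i y" for i
    unfolding t_def theta_moment_def using summable_theta_coeff[OF q] by (rule summable_sums)
  have s0: "(\<lambda>n. t 0 n - (if n = 0 then 1 else 0)) sums (theta_moment 0 y - 1)"
    by (intro sums_diff s) (use sums_single[of 0 "\<lambda>_. 1::real"] in simp)
  \<comment> \<open>The minimizer of the quadratic polynomial in \<open>r\<close> obtained by
    summing \<open>(n - r)^2\<close> against the weights with \<open>n > 0\<close>.\<close>
  define r where "r = theta_moment 1 y / (theta_moment 0 y - 1)"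
  have pos: "theta_moment 0 y - 1 > 0" using theta_moment_0_ge[OF y] by simp
  have sums: "(\<lambda>n. t 2 n - 2 * r * t 1 n + r\<^sup>2 * (t 0 n - (if n = 0 then 1 else 0))) sums
     (theta_moment 2 y - 2 * r * theta_moment 1 y + r\<^sup>2 * (theta_moment 0 y - 1))"
    by (rule sums_add[OF sums_diff[OF s sums_mult[OF s]] sums_mult[OF s0]])
  have nonneg: "0 \<le> t 2 n - 2 * r * t 1 n + r\<^sup>2 * (t 0 n - (if n = 0 then 1 else 0))" for n
  proof (cases "n = 0")
    case False
    have "t 2 n - 2 * r * t 1 n + r\<^sup>2 * t 0 n = (real n - r)\<^sup>2 * (theta_coeff n * exp (- y) ^ n)"
      unfolding t_def by algebra
    also have "\<dots> \<ge> 0" by (simp add: theta_coeff_def)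
    finally show ?thesis using False by simp
  qed (simp add: t_def theta_coeff_def)
  have "0 \<le> theta_moment 2 y - 2 * r * theta_moment 1 y + r\<^sup>2 * (theta_moment 0 y - 1)"
    by (rule sums_le[OF nonneg sums_zero sums])
  moreover have r: "r * (theta_moment 0 y - 1) = theta_moment 1 y" using pos by (simp add: r_def)
  hence "r\<^sup>2 * (theta_moment 0 y - 1) = r * theta_moment 1 y" by (simp only: power2_eq_square mult.assoc)
  ultimately have "r * theta_moment 1 y \<le> theta_moment 2 y" by linarith
  hence "r * theta_moment 1 y * (theta_moment 0 y - 1) \<le> theta_moment 2 y * (theta_moment 0 y - 1)"
    using pos by (intro mult_right_mono) auto
  moreover have "r * theta_moment 1 y * (theta_moment 0 y - 1) = (theta_moment 1 y)\<^sup>2"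
    unfolding r[symmetric] by (simp only: power2_eq_square mult_ac)
  ultimately show ?thesis by simp
qed

section \<open>Monotonicity of the logarithmic slope\<close>

definition theta_slope :: "real \<Rightarrow> real" where
  "theta_slope u = 1 / 4 - pi * exp u * theta_moment 1 (pi * exp u) / theta_moment 0 (pi * exp u)"

text \<open>The summand \<open>u / 4\<close> makes the function even, by the functional equation.\<close>

definition log_theta :: "real \<Rightarrow> real" where
  "log_theta u = ln (jtheta (exp u)) + u / 4"

lemma log_theta_minus: "log_theta (- u) = log_theta u"
proof -
  have "jtheta (exp (- u)) = sqrt (exp u) * jtheta (exp u)"
    using jtheta_inverse[of "exp u"] by (simp add: exp_minus inverse_eq_divide)
  hence "ln (jtheta (exp (- u))) = u / 2 + ln (jtheta (exp u))"
    using jtheta_pos[of "exp u"] by (simp add: ln_mult ln_sqrt)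
  thus ?thesis by (simp add: log_theta_def)
qed

lemma log_theta_deriv: "(log_theta has_real_derivative theta_slope u) (at u)"
proof -
  have eq: "log_theta = (\<lambda>u. ln (theta_moment 0 (pi * exp u)) + u / 4)"
    by (rule ext) (simp add: log_theta_def jtheta_conv_moment)
  have d: "((\<lambda>u. theta_moment 0 (pi * exp u)) has_real_derivative - theta_moment 1 (pi * exp u) * (pi * exp u)) (at u)"
    by (rule DERIV_chain2[where f = "theta_moment 0"], rule theta_moment_deriv[of _ 0, folded One_nat_def])
       (auto intro!: derivative_eq_intros)
  have pos: "theta_moment 0 (pi * exp u) > 0" by (intro theta_moment_pos) simp
  have gen: "((\<lambda>u. ln (f u) + u / 4) has_real_derivative 1 / f u * D + 1 / 4) (at u)"
    if "(f has_real_derivative D) (at u)" "f u > 0" for f :: "real \<Rightarrow> real" and D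
    using that by (auto intro!: derivative_eq_intros)
  have "(log_theta has_real_derivative
      1 / theta_moment 0 (pi * exp u) * (- theta_moment 1 (pi * exp u) * (pi * exp u)) + 1 / 4) (at u)"
    unfolding eq by (rule gen[OF d pos])
  moreover have "1 / theta_moment 0 (pi * exp u) * (- theta_moment 1 (pi * exp u) * (pi * exp u)) + 1 / 4 = theta_slope u"
    by (simp add: theta_slope_def mult_ac)
  ultimately show ?thesis by (simp only:)
qed

lemma theta_slope_minus: "theta_slope (- u) = - theta_slope u"
proof -
  have "((\<lambda>u. log_theta (- u)) has_real_derivative theta_slope (- u) * (- 1)) (at u)"
    by (rule DERIV_chain2[where f = log_theta], rule log_theta_deriv) (auto intro!: derivative_eq_intros)
  hence "(log_theta has_real_derivative - theta_slope (- u)) (at u)"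
    by (simp add: log_theta_minus)
  from DERIV_unique[OF this log_theta_deriv] show ?thesis by simp
qed

text \<open>With \<open>P i\<close> the moments at \<open>y = pi * exp w\<close>, the derivative is
  \<open>y / (P 0)^2\<close> times \<open>y * (P 0 * P 2 - (P 1)^2) - P 0 * P 1\<close>. By
  Cauchy-Schwarz the first term is at least \<open>y * P 2\<close>, which exceeds
  \<open>P 0 * P 2 \<ge> P 0 * P 1\<close> once \<open>P 0 < y\<close>. That last inequality is
  where \<open>w \<ge> 0\<close>, hence \<open>y \<ge> pi\<close>, enters.\<close>

lemma theta_slope_strict_mono_nonneg:
  assumes "0 \<le> u" "u < v"
  shows "theta_slope u < theta_slope v"
proof (rule DERIV_pos_imp_increasing[OF assms(2)])
  fix w assume w: "u \<le> w" "w \<le> v"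
  define y where "y = pi * exp w"
  have "exp w \<ge> 1" using w assms by simp
  hence y: "y \<ge> pi" by (simp add: y_def)
  hence y0: "y > 0" using pi_gt_zero by linarith
  define P where "P i = theta_moment i y" for i
  have P0: "P 0 > 1" unfolding P_def by (rule theta_moment_0_ge[OF y0])
  have P2: "P 2 > 0" unfolding P_def by (rule theta_moment_pos[OF y0])
  have P12: "P 1 \<le> P 2" unfolding P_def by (rule theta_moment_1_le_2[OF y0])
  have CS: "(P 1)\<^sup>2 \<le> P 2 * (P 0 - 1)" unfolding P_def by (rule theta_moment_cauchy_schwarz[OF y0])
  have P0y: "P 0 < y"
  proof -
    have "exp y > 2" using exp_ge_add_one_self[of y] y pi_gt3 by linarith
    hence "2 / (exp y - 1) < 2" using y0 by (subst pos_divide_less_eq) auto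
    thus ?thesis using theta_moment_0_le[OF y0] y pi_gt3 by (simp add: P_def)
  qed
  have d: "((\<lambda>u. theta_moment i (pi * exp u)) has_real_derivative - P (Suc i) * y) (at w)" for i
    unfolding P_def y_def
    by (rule DERIV_chain2[where f = "theta_moment i"], rule theta_moment_deriv) (auto intro!: derivative_eq_intros)
  define D where "D = - (((y * P 1 + y * (- P 2 * y)) * P 0 - y * P 1 * (- P 1 * y)) / (P 0 * P 0))"
  have "(theta_slope has_real_derivative D) (at w)"
    unfolding theta_slope_def[abs_def] D_def
    using d[of 0] d[of 1] P0 
    by (auto intro!: derivative_eq_intros simp: P_def y_def numeral_2_eq_2 algebra_simps)
  moreover have "D > 0"
  proof -
    have "y * (P 1)\<^sup>2 \<le> y * (P 2 * (P 0 - 1))" using CS y0 by (intro mult_left_mono) auto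
    also have "\<dots> = P 0 * (y * P 2) - y * P 2" by (simp add: algebra_simps)
    also have "\<dots> < P 0 * (y * P 2) - P 0 * P 2" using P0y P2 by simp
    also have "\<dots> \<le> P 0 * (y * P 2) - P 0 * P 1" using P12 P0 by (simp add: mult_left_mono)
    finally have "y * (y * (P 1)\<^sup>2) < y * (P 0 * (y * P 2) - P 0 * P 1)" using y0 by simp
    hence "((y * P 1 + y * (- P 2 * y)) * P 0 - y * P 1 * (- P 1 * y)) / (P 0 * P 0) < 0"
      using P0 by (intro divide_neg_pos mult_pos_pos) (auto simp: power2_eq_square algebra_simps)
    thus ?thesis by (simp add: D_def)
  qed
  ultimately show "\<exists>d. (theta_slope has_real_derivative d) (at w) \<and> 0 < d" by blast
qed

lemma theta_slope_strict_mono: "u < v \<Longrightarrow> theta_slope u < theta_slope v"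
proof -
  assume uv: "u < v"
  have z: "theta_slope 0 = 0" using theta_slope_minus[of 0] by simp
  consider "0 \<le> u" | "v \<le> 0" | "u < 0" "0 < v" by linarith
  thus ?thesis
  proof cases
    case 1 thus ?thesis using uv by (rule theta_slope_strict_mono_nonneg)
  next
    case 2 thus ?thesis using theta_slope_strict_mono_nonneg[of "- v" "- u"] uv by (simp add: theta_slope_minus)
  next
    case 3 thus ?thesis using theta_slope_strict_mono_nonneg[of 0 v] theta_slope_strict_mono_nonneg[of 0 "- u"]
      by (simp add: theta_slope_minus z)
  qed
qed

lemma log_theta_tangent:
  assumes "u \<noteq> v"
  shows "log_theta u + theta_slope u * (v - u) < log_theta v"
proof (cases "u < v")
  case True
  from MVT2[OF True, of log_theta theta_slope] obtain z where z: "u < z" "z < v"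
    "log_theta v - log_theta u = (v - u) * theta_slope z" using log_theta_deriv by blast
  have "(v - u) * theta_slope u < (v - u) * theta_slope z"
    using True theta_slope_strict_mono[OF z(1)] by simp
  thus ?thesis using z(3) by (simp add: mult.commute)
next
  case False
  hence vu: "v < u" using assms by simp
  from MVT2[OF vu, of log_theta theta_slope] obtain z where z: "v < z" "z < u"
    "log_theta u - log_theta v = (u - v) * theta_slope z" using log_theta_deriv by blast
  have "(u - v) * theta_slope z < (u - v) * theta_slope u"
    using vu theta_slope_strict_mono[OF z(2)] by simp
  thus ?thesis using z(3) by (simp add: algebra_simps)
qed

text \<open>Jensen's inequality at \<open>ln x\<close>, via the tangent line; the linear terms sum to zero.\<close>

lemma
  fixes c :: "'a \<Rightarrow> real"
  assumes fin: "finite S" and pos: "\<And>j. j \<in> S \<Longrightarrow> c j > 0" and prod1: "prod c S = 1" and x: "x > 0"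
  shows prod_jtheta_ge: "jtheta x ^ card S \<le> (\<Prod>j\<in>S. jtheta (x * c j))"
    and prod_jtheta_gt: "\<exists>j\<in>S. c j \<noteq> 1 \<Longrightarrow> jtheta x ^ card S < (\<Prod>j\<in>S. jtheta (x * c j))"
proof -
  define T where "T = (\<lambda>j. log_theta (ln x) + theta_slope (ln x) * ln (c j))"
  have lnx: "ln (x * c j) = ln x + ln (c j)" if "j \<in> S" for j
    using pos[OF that] x by (simp add: ln_mult)
  have lt: "T j < log_theta (ln x + ln (c j))" if "j \<in> S" "c j \<noteq> 1" for j
    using log_theta_tangent[of "ln x" "ln x + ln (c j)"] that pos[of j] by (simp add: T_def)
  have le: "T j \<le> log_theta (ln x + ln (c j))" if "j \<in> S" for j
    using lt[OF that] by (cases "c j = 1") (auto simp: T_def)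
  have jt: "j \<in> S \<Longrightarrow> 0 < jtheta (x * c j)" "j \<in> S \<Longrightarrow> jtheta (x * c j) \<noteq> 0" for j
    using jtheta_pos[of "x * c j"] pos[of j] x by simp_all
  have sum_ln: "(\<Sum>j\<in>S. ln (c j)) = 0"
  proof -
    have "ln (prod c S) = (\<Sum>j\<in>S. ln (c j))" using pos by (intro ln_prod[OF fin]) force
    thus ?thesis using prod1 by simp
  qed
  have sumT: "sum T S = ln (jtheta x ^ card S) + card S * (ln x / 4)"
  proof -
    have "sum T S = card S * log_theta (ln x) + theta_slope (ln x) * (\<Sum>j\<in>S. ln (c j))"
      by (simp add: T_def sum.distrib sum_distrib_left)
    also have "\<dots> = card S * log_theta (ln x)" by (simp add: sum_ln)
    also have "log_theta (ln x) = ln (jtheta x) + ln x / 4" using x by (simp add: log_theta_def)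
    finally show ?thesis using jtheta_pos[OF x] by (simp add: ln_realpow distrib_left)
  qed
  have "(\<Sum>j\<in>S. log_theta (ln x + ln (c j))) = (\<Sum>j\<in>S. ln (jtheta (x * c j)) + ln x / 4 + ln (c j) / 4)"
    using x pos by (intro sum.cong) (auto simp: log_theta_def exp_add add_divide_distrib)
  also have "\<dots> = ln (\<Prod>j\<in>S. jtheta (x * c j)) + card S * (ln x / 4)"
  proof -
    have "ln (\<Prod>j\<in>S. jtheta (x * c j)) = (\<Sum>j\<in>S. ln (jtheta (x * c j)))"
      using jt by (intro ln_prod[OF fin])
    moreover have "(\<Sum>j\<in>S. ln (c j) / 4) = 0" by (simp add: sum_ln flip: sum_divide_distrib)
    ultimately show ?thesis by (simp add: sum.distrib)
  qed
  finally have sumR: "(\<Sum>j\<in>S. log_theta (ln x + ln (c j))) = ln (\<Prod>j\<in>S. jtheta (x * c j)) + card S * (ln x / 4)" .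
  have P: "(\<Prod>j\<in>S. jtheta (x * c j)) > 0" "jtheta x ^ card S > 0"
    by (auto intro!: prod_pos zero_less_power jtheta_pos jt x)
  have "sum T S \<le> (\<Sum>j\<in>S. log_theta (ln x + ln (c j)))" using le by (rule sum_mono)
  thus "jtheta x ^ card S \<le> (\<Prod>j\<in>S. jtheta (x * c j))" using P by (simp add: sumT sumR)
  assume "\<exists>j\<in>S. c j \<noteq> 1"
  hence "sum T S < (\<Sum>j\<in>S. log_theta (ln x + ln (c j)))" using le lt by (intro sum_strict_mono_ex1[OF fin]) auto
  thus "jtheta x ^ card S < (\<Prod>j\<in>S. jtheta (x * c j))" using P by (simp add: sumT sumR)
qed

subsection \<open>Mellin transforms in the logarithmic variable\<close>

text \<open>
  Mellin integrals are taken in \<open>u = ln x\<close>, so that inversion and scaling of \<open>x\<close> become reflection and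
  translation of \<open>u\<close>.
\<close>

definition rapid :: "(real \<Rightarrow> real) \<Rightarrow> bool" where
  "rapid w \<longleftrightarrow> w \<in> borel_measurable borel \<and> (\<forall>a. \<exists>K. \<forall>u\<ge>0. \<bar>w u\<bar> \<le> K * exp (- a * u))"

definition laplace :: "(real \<Rightarrow> real) \<Rightarrow> complex \<Rightarrow> complex" where
  "laplace w s = (LINT u:{0<..}|lborel. exp (s * of_real u) * of_real (w u))"

lemma half_line_exp:
  fixes z :: complex
  assumes "Re z > 0"
  shows half_line_exp_integrable: "set_integrable lborel {0<..} (\<lambda>u. exp (- z * of_real u))"
    and half_line_exp_integral: "(LINT u:{0<..}|lborel. exp (- z * of_real u)) = 1 / z"
proof -
  have "(\<lambda>x. exp (- Re z * x)) integrable_on {0..}"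
    using has_integral_exp_minus_to_infinity[OF assms, of 0] by blast
  hence "set_integrable lebesgue {0..} (\<lambda>x. exp (- Re z * x))"
    by (intro nonnegative_absolutely_integrable_1) auto
  hence "set_integrable lebesgue {0<..} (\<lambda>x. exp (- Re z * x))"
    by (rule set_integrable_subset) auto
  hence "set_integrable lborel {0<..} (\<lambda>x. exp (- Re z * x))"
    unfolding set_integrable_def by (subst (asm) integrable_completion) auto
  thus 1: "set_integrable lborel {0<..} (\<lambda>u. exp (- z * of_real u))"
    by (rule set_integrable_bound) (auto simp: set_borel_measurable_def)
  have "(LBINT u=0..\<infinity>. exp (- z * of_real u)) = 0 - (- 1 / z)"
  proof (rule interval_integral_FTC_integrable)
    show "((\<lambda>u. - exp (- z * of_real u) / z) has_vector_derivative exp (- z * of_real u)) (at u)" for u :: real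
      using assms by (auto intro!: derivative_eq_intros has_vector_derivative_real_field)
    show "set_integrable lborel (einterval 0 \<infinity>) (\<lambda>u. exp (- z * of_real u))"
      using 1 by (simp add: einterval_def zero_ereal_def greaterThan_def)
    have "((\<lambda>u. - exp (- z * of_real u) / z) \<longlongrightarrow> - exp (- z * of_real 0) / z) (at_right 0)"
      using assms by (intro tendsto_intros) auto
    thus "(((\<lambda>u. - exp (- z * of_real u) / z) \<circ> real_of_ereal) \<longlongrightarrow> - 1 / z) (at_right 0)"
      by (simp add: zero_ereal_def ereal_tendsto_simps)
    have "filterlim (\<lambda>u. - (Re z * u)) at_bot at_top"
      using assms by (simp add: filterlim_uminus_at_bot filterlim_tendsto_pos_mult_at_top[OF tendsto_const _ filterlim_ident])
    hence "((\<lambda>u. exp (- (Re z * u))) \<longlongrightarrow> 0) at_top"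
      by (rule filterlim_compose[OF exp_at_bot])
    hence "((\<lambda>u. exp (- z * complex_of_real u)) \<longlongrightarrow> 0) at_top"
      by (subst tendsto_norm_zero_iff[symmetric]) simp
    hence "((\<lambda>u. - exp (- z * complex_of_real u) / z) \<longlongrightarrow> - 0 / z) at_top"
      using assms by (intro tendsto_intros) auto
    thus "(((\<lambda>u. - exp (- z * of_real u) / z) \<circ> real_of_ereal) \<longlongrightarrow> 0) (at_left \<infinity>)"
      by (simp add: ereal_tendsto_simps)
  qed auto
  thus "(LINT u:{0<..}|lborel. exp (- z * of_real u)) = 1 / z"
    by (simp add: interval_lebesgue_integral_0_infty)
qed

lemma rapid_measurable [measurable_dest]: "rapid w \<Longrightarrow> w \<in> borel_measurable borel"
  by (simp add: rapid_def)

lemma rapidE: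
  assumes "rapid w"
  obtains K where "K \<ge> 0" "\<And>u. u \<ge> 0 \<Longrightarrow> \<bar>w u\<bar> \<le> K * exp (- a * u)"
proof -
  from assms obtain K where K: "\<And>u. u \<ge> 0 \<Longrightarrow> \<bar>w u\<bar> \<le> K * exp (- a * u)"
    unfolding rapid_def by blast
  from K[of 0] have "K \<ge> 0" by simp
  with K that show ?thesis by blast
qed

text \<open>Decay of \<open>w\<close> at rate \<open>b + 1\<close> absorbs the growth
  \<open>exp (b * u)\<close> and still leaves \<open>exp (- u)\<close>.\<close>

lemma rapid_integrable:
  assumes w: "rapid w" and f: "f \<in> borel_measurable borel"
    and bound: "\<And>u. u > 0 \<Longrightarrow> norm (f u :: complex) \<le> C * exp (b * u) * \<bar>w u\<bar>"
  shows "set_integrable lborel {0<..} f"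
proof -
  obtain K where K: "K \<ge> 0" "\<And>u. u \<ge> 0 \<Longrightarrow> \<bar>w u\<bar> \<le> K * exp (- (b + 1) * u)"
    using rapidE[OF w] by blast
  have "set_integrable lborel {0<..} (\<lambda>u. of_real (\<bar>C\<bar> * K) * exp (- 1 * complex_of_real u))"
    by (intro set_integrable_mult_right half_line_exp_integrable) auto
  thus ?thesis
  proof (rule set_integrable_bound)
    show "set_borel_measurable lborel {0<..} f"
      using f unfolding set_borel_measurable_def by measurable
    have "norm (f u) \<le> \<bar>C\<bar> * K * exp (- u)" if u: "u > 0" for u
    proof -
      have "norm (f u) \<le> C * exp (b * u) * \<bar>w u\<bar>" by (rule bound[OF u])
      also have "\<dots> \<le> \<bar>C\<bar> * exp (b * u) * (K * exp (- (b + 1) * u))"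
        using K u by (intro mult_mono) auto
      also have "\<dots> = \<bar>C\<bar> * K * (exp (b * u) * exp (- (b + 1) * u))" by simp
      also have "exp (b * u) * exp (- (b + 1) * u) = exp (- u)"
        by (simp add: algebra_simps flip: exp_add)
      finally show ?thesis .
    qed
    thus "AE u\<in>{0<..} in lborel. norm (f u) \<le> norm (of_real (\<bar>C\<bar> * K) * exp (- 1 * complex_of_real u))"
      using K by (intro AE_I2) (auto simp: norm_mult)
  qed
qed

lemma laplace_integrable:
  assumes "rapid w"
  shows "set_integrable lborel {0<..} (\<lambda>u. exp (s * of_real u) * complex_of_real (w u))"
proof (rule rapid_integrable[OF assms, where C = 1 and b = "Re s"])
  show "(\<lambda>u. exp (s * of_real u) * complex_of_real (w u)) \<in> borel_measurable borel"
    using rapid_measurable[OF assms] by measurable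
qed (auto simp: norm_mult)

text \<open>Expanding \<open>exp (s u)\<close> under the integral gives a power series in \<open>s\<close> that converges everywhere.\<close>

lemma laplace_holomorphic:
  assumes w: "rapid w"
  shows "laplace w holomorphic_on A"
proof -
  define g where "g k u = indicator {0<..} u *\<^sub>R (of_real u ^ k / fact k * complex_of_real (w u))" for k u
  define c where "c k = (\<integral>u. g k u \<partial>lborel)" for k
  have wm [measurable]: "w \<in> borel_measurable borel" by (rule rapid_measurable[OF w])
  have pow_le: "\<bar>u\<bar> ^ k / fact k \<le> exp u" if "u > 0" for u :: real and k
    using that sum_le_suminf[OF sums_summable[OF exp_converges[of u]], of "{k}"] sums_unique[OF exp_converges[of u]]
    by (simp add: divide_inverse mult.commute)
  have int_g: "integrable lborel (g k)" for k
    unfolding g_def set_integrable_def[symmetric]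
  proof (rule rapid_integrable[OF w, where C = 1 and b = 1])
    fix u :: real assume u: "u > 0"
    show "norm (of_real u ^ k / fact k * complex_of_real (w u)) \<le> 1 * exp (1 * u) * \<bar>w u\<bar>"
      using mult_right_mono[OF pow_le[OF u, of k], of "\<bar>w u\<bar>"]
      by (simp add: norm_mult norm_divide norm_power)
  qed measurable
  have series: "(\<lambda>k. c k * s ^ k) sums laplace w s" for s
  proof -
    have pw: "(\<lambda>k. g k u * s ^ k) sums (indicator {0<..} u *\<^sub>R (exp (s * of_real u) * complex_of_real (w u)))" for u
    proof -
      have "(\<lambda>k. (s * of_real u) ^ k /\<^sub>R fact k * (indicator {0<..} u *\<^sub>R complex_of_real (w u))) sums
        (exp (s * of_real u) * (indicator {0<..} u *\<^sub>R complex_of_real (w u)))"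
        by (intro sums_mult2 exp_converges)
      thus ?thesis unfolding g_def
        by (simp add: power_mult_distrib scaleR_conv_of_real field_simps)
    qed
    \<comment> \<open>The series of norms sums to a single function, integrable for every
      \<open>s\<close>; it justifies the exchange of sum and integral.\<close>
    have pwn: "(\<lambda>k. norm (g k u * s ^ k)) sums (indicator {0<..} u *\<^sub>R (exp (norm s * u) * \<bar>w u\<bar>))" for u
    proof -
      have "(\<lambda>k. (norm s * u) ^ k /\<^sub>R fact k * (indicator {0<..} u *\<^sub>R \<bar>w u\<bar>)) sums
        (exp (norm s * u) * (indicator {0<..} u *\<^sub>R \<bar>w u\<bar>))"
        by (intro sums_mult2 exp_converges)
      thus ?thesis unfolding g_def
        by (cases "u > 0")
           (simp_all add: power_mult_distrib norm_mult norm_divide norm_power field_simps)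
    qed
    have int_abs: "integrable lborel (\<lambda>u. indicator {0<..} u *\<^sub>R (exp (norm s * u) * \<bar>w u\<bar>))"
    proof -
      have "set_integrable lborel {0<..} (\<lambda>u. complex_of_real (exp (norm s * u) * \<bar>w u\<bar>))"
        by (rule rapid_integrable[OF w, where C = 1 and b = "norm s"]) (auto simp: norm_mult)
      from integrable_Re[OF this[unfolded set_integrable_def]] show ?thesis
        by simp
    qed
    have "(\<lambda>k. \<integral>u. g k u * s ^ k \<partial>lborel) sums (\<integral>u. (\<Sum>k. g k u * s ^ k) \<partial>lborel)"
    proof (rule sums_integral)
      show "integrable lborel (\<lambda>u. g k u * s ^ k)" for k by (intro integrable_mult_left int_g)
      show "AE u in lborel. summable (\<lambda>k. norm (g k u * s ^ k))"
        using pwn by (intro AE_I2) (rule sums_summable)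
      show "summable (\<lambda>k. \<integral>u. norm (g k u * s ^ k) \<partial>lborel)"
      proof (rule summableI_nonneg_bounded)
        fix n
        have "(\<Sum>k<n. \<integral>u. norm (g k u * s ^ k) \<partial>lborel) = (\<integral>u. (\<Sum>k<n. norm (g k u * s ^ k)) \<partial>lborel)"
          by (intro Bochner_Integration.integral_sum[symmetric] integrable_norm integrable_mult_left int_g)
        also have "\<dots> \<le> (\<integral>u. indicator {0<..} u *\<^sub>R (exp (norm s * u) * \<bar>w u\<bar>) \<partial>lborel)"
          by (intro integral_mono int_abs Bochner_Integration.integrable_sum integrable_norm integrable_mult_left int_g)
             (use sum_le_suminf[OF sums_summable[OF pwn]] sums_unique[OF pwn] in auto)
        finally show "(\<Sum>k<n. \<integral>u. norm (g k u * s ^ k) \<partial>lborel) \<le>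
           (\<integral>u. indicator {0<..} u *\<^sub>R (exp (norm s * u) * \<bar>w u\<bar>) \<partial>lborel)" .
      qed auto
    qed
    also have "(\<integral>u. (\<Sum>k. g k u * s ^ k) \<partial>lborel) = laplace w s"
      unfolding laplace_def set_lebesgue_integral_def using sums_unique[OF pw] by simp
    also have "(\<lambda>k. \<integral>u. g k u * s ^ k \<partial>lborel) = (\<lambda>k. c k * s ^ k)"
      by (simp add: c_def)
    finally show ?thesis .
  qed
  have "laplace w = (\<lambda>s. \<Sum>k. c k * s ^ k)"
    using series by (auto simp: sums_iff)
  moreover have "((\<lambda>s. \<Sum>k. c k * s ^ k) has_field_derivative (\<Sum>k. diffs c k * s ^ k)) (at s)" for s
    by (rule termdiffs_strong_converges_everywhere) (use series in \<open>auto simp: sums_iff\<close>)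
  ultimately show ?thesis
    by (simp add: holomorphic_on_def field_differentiable_def)
       (blast intro: has_field_derivative_at_within)
qed

lemma two_sided_integral:
  fixes f :: "real \<Rightarrow> complex"
  assumes p: "set_integrable lborel {0<..} f" and n: "set_integrable lborel {0<..} (\<lambda>u. f (- u))"
    and f: "f \<in> borel_measurable borel"
  shows two_sided_integrable: "integrable lborel f"
    and two_sided_integral_eq: "(\<integral>u. f u \<partial>lborel) =
      (LINT u:{0<..}|lborel. f u) + (LINT u:{0<..}|lborel. f (- u))"
proof -
  have ind: "indicator {0<..} (- u) *\<^sub>R f u = indicator {..<0} u *\<^sub>R f u" for u
    by (auto simp: indicator_def)
  have n': "set_integrable lborel {..<0} f"
    using lborel_integrable_real_affine[OF n[unfolded set_integrable_def], of "-1" 0]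
    unfolding set_integrable_def by (simp add: ind)
  have ni: "(LINT u:{0<..}|lborel. f (- u)) = (LINT u:{..<0}|lborel. f u)"
    unfolding set_lebesgue_integral_def
    by (subst lborel_integral_real_affine[where c = "-1" and t = 0]) (simp_all add: ind)
  have un: "set_integrable lborel ({0<..} \<union> {..<0}) f"
    by (intro set_integrable_Un p n') auto
  have ae: "AE u in lborel. indicator ({0<..} \<union> {..<0}) u *\<^sub>R f u = f u"
    using AE_lborel_singleton[of "0::real"] by eventually_elim (auto simp: indicator_def)
  have m1: "(\<lambda>u. indicator ({0<..} \<union> {..<0}) u *\<^sub>R f u) \<in> borel_measurable lborel"
    using un unfolding set_integrable_def by (rule borel_measurable_integrable)
  show "integrable lborel f"
    using un f unfolding set_integrable_def by (subst integrable_cong_AE[OF _ _ ae, symmetric]) auto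
  have "(\<integral>u. f u \<partial>lborel) = (LINT u:({0<..} \<union> {..<0})|lborel. f u)"
    unfolding set_lebesgue_integral_def using f m1 ae by (intro integral_cong_AE) (auto elim: eventually_mono)
  also have "\<dots> = (LINT u:{0<..}|lborel. f u) + (LINT u:{..<0}|lborel. f u)"
    by (rule set_integral_Un[OF _ p n']) auto
  finally show "(\<integral>u. f u \<partial>lborel) = (LINT u:{0<..}|lborel. f u) + (LINT u:{0<..}|lborel. f (- u))"
    by (simp add: ni)
qed

text \<open>Folding the negative half line onto the positive one turns \<open>P (- u) - 1\<close>
  into \<open>exp (a * u) * (Q u - 1)\<close>, which decays rapidly, plus
  \<open>exp (a * u) - 1\<close>, which does not. The last two terms integrate to the two explicit
  fractions, and for them \<open>Re s > a\<close> is required.\<close>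

lemma
  assumes P: "rapid (\<lambda>u. P u - 1)" and Q: "rapid (\<lambda>u. Q u - 1)"
    and reflect: "\<And>u. P (- u) = exp (a * u) * Q u"
    and a: "a > 0" and s: "Re s > a"
  shows mellin_integrable: "integrable lborel (\<lambda>u. exp (s * of_real u) * complex_of_real (P u - 1))"
    and mellin_integral: "(\<integral>u. exp (s * of_real u) * complex_of_real (P u - 1) \<partial>lborel) =
      laplace (\<lambda>u. P u - 1) s + laplace (\<lambda>u. Q u - 1) (of_real a - s) + 1 / (s - of_real a) - 1 / s"
proof -
  let ?f = "\<lambda>u. exp (s * of_real u) * complex_of_real (P u - 1)"
  let ?g = "\<lambda>u. exp ((of_real a - s) * of_real u) * complex_of_real (Q u - 1)"
  have meas: "?f \<in> borel_measurable borel"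
    using rapid_measurable[OF P] by measurable
  have eq: "?f (- u) = ?g u + exp (- (s - of_real a) * of_real u) - exp (- s * of_real u)" for u
  proof -
    have "exp (complex_of_real a * of_real u) = of_real (exp (a * u))"
      by (simp add: exp_of_real flip: of_real_mult)
    hence "exp ((of_real a - s) * of_real u) = exp (- s * of_real u) * complex_of_real (exp (a * u))"
      by (simp add: algebra_simps exp_diff exp_minus exp_of_real divide_inverse)
    moreover have "- (s - of_real a) * complex_of_real u = (of_real a - s) * of_real u" by simp
    ultimately show ?thesis by (simp only: reflect) (simp add: algebra_simps)
  qed
  have i1: "set_integrable lborel {0<..} ?g" by (rule laplace_integrable[OF Q])
  have i2: "set_integrable lborel {0<..} (\<lambda>u. exp (- (s - of_real a) * of_real u))"
    using s by (intro half_line_exp_integrable) simp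
  have i3: "set_integrable lborel {0<..} (\<lambda>u. exp (- s * of_real u))"
    using s a by (intro half_line_exp_integrable) simp
  have n: "set_integrable lborel {0<..} (\<lambda>u. ?f (- u))"
    unfolding eq by (intro set_integral_add set_integral_diff i1 i2 i3)
  have p: "set_integrable lborel {0<..} ?f" by (rule laplace_integrable[OF P])
  show "integrable lborel ?f" by (rule two_sided_integrable[OF p n meas])
  have "(LINT u:{0<..}|lborel. ?f (- u)) = laplace (\<lambda>u. Q u - 1) (of_real a - s) + 1 / (s - of_real a) - 1 / s"
    unfolding eq using i1 i2 i3 s a half_line_exp_integral[of "s - of_real a"] half_line_exp_integral[of s]
    by (simp only: set_integral_add set_integral_diff laplace_def) simp
  thus "(\<integral>u. ?f u \<partial>lborel) =
      laplace (\<lambda>u. P u - 1) s + laplace (\<lambda>u. Q u - 1) (of_real a - s) + 1 / (s - of_real a) - 1 / s"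
    by (subst two_sided_integral_eq[OF p n meas]) (simp add: laplace_def)
qed

section \<open>Sums of powers as Mellin transforms\<close>

lemma integrable_from_abs_lebesgue:
  fixes f :: "real \<Rightarrow> real"
  assumes "f absolutely_integrable_on UNIV" "f \<in> borel_measurable borel"
  shows "integrable lborel f" "(\<integral>u. f u \<partial>lborel) = integral UNIV f"
proof -
  show 1: "integrable lborel f"
    using assms unfolding set_integrable_def by (simp add: integrable_completion)
  hence "set_integrable lborel UNIV f" by (simp add: set_integrable_def)
  from set_borel_integral_eq_integral(2)[OF this] show "(\<integral>u. f u \<partial>lborel) = integral UNIV f"
    by (simp add: set_lebesgue_integral_def)
qed

text \<open>Euler's integral after the substitution \<open>t = exp u\<close>; the Jacobian
  \<open>exp u\<close> turns the exponent \<open>s - 1\<close> into \<open>s\<close>.\<close>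

lemma
  assumes s: "Re s > 0"
  shows Gamma_exp_integrable_1: "integrable lborel (\<lambda>u. exp (s * of_real u) * complex_of_real (exp (- exp u)))"
    and Gamma_exp_integral_1: "(\<integral>u. exp (s * of_real u) * complex_of_real (exp (- exp u)) \<partial>lborel) = Gamma s"
proof -
  let ?h = "\<lambda>t. complex_of_real t powr (s - 1) / of_real (exp t)"
  let ?f = "\<lambda>u. exp (s * of_real u) * complex_of_real (exp (- exp u))"
  have abs: "?h absolutely_integrable_on {0<..}" by (rule absolutely_integrable_Gamma_integral'[OF s])
  have h_eq: "exp u *\<^sub>R ?h (exp u) = ?f u" for u :: real
  proof -
    have "complex_of_real (exp u) powr (s - 1) = exp ((s - 1) * of_real u)"
      by (simp add: powr_def Ln_of_real)
    thus ?thesis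
      by (simp add: scaleR_conv_of_real exp_minus exp_of_real[symmetric] field_simps exp_diff)
  qed
  have img: "range exp = {0::real<..}" 
    by (auto simp: image_iff) (metis exp_ln)
  \<comment> \<open>The change of variables is carried out for real-valued integrands;
    \<open>F\<close> stands for \<open>Re\<close> or \<open>Im\<close>.\<close>
  have part: "integrable lborel (\<lambda>u. F (?f u)) \<and> (\<integral>u. F (?f u) \<partial>lborel) = integral {0<..} (\<lambda>t. F (?h t))"
    if F: "bounded_linear F" for F :: "complex \<Rightarrow> real"
  proof -
    interpret bounded_linear F by (rule F)
    have absF: "(\<lambda>t. F (?h t)) absolutely_integrable_on {0<..}"
      using absolutely_integrable_linear[OF abs F] by (simp add: o_def)
    have "(\<lambda>u. \<bar>exp u\<bar> * F (?h (exp u))) absolutely_integrable_on UNIV \<and>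
        integral UNIV (\<lambda>u. \<bar>exp u\<bar> * F (?h (exp u))) = integral {0<..} (\<lambda>t. F (?h t))"
      using absF by (subst has_absolute_integral_change_of_variables_1'[where g = exp and g' = exp])
         (auto simp: img inj_def intro: DERIV_exp)
    also have "(\<lambda>u. \<bar>exp u\<bar> * F (?h (exp u))) = (\<lambda>u. F (?f u))"
    proof
      fix u :: real
      have "\<bar>exp u\<bar> * F (?h (exp u)) = F (exp u *\<^sub>R ?h (exp u))" by (simp only: scaleR abs_exp_cancel real_scaleR_def)
      thus "\<bar>exp u\<bar> * F (?h (exp u)) = F (?f u)" by (simp only: h_eq)
    qed
    finally have *: "(\<lambda>u. F (?f u)) absolutely_integrable_on UNIV" "integral UNIV (\<lambda>u. F (?f u)) = integral {0<..} (\<lambda>t. F (?h t))"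
      by blast+
    have "(\<lambda>u. F (?f u)) \<in> borel_measurable borel"
      by (rule measurable_compose[OF _ borel_measurable_continuous_onI[OF linear_continuous_on[OF F]]]) measurable
    from integrable_from_abs_lebesgue[OF *(1) this] *(2) show ?thesis by simp
  qed
  have G: "integral {0<..} ?h = Gamma s" "?h integrable_on {0<..}"
    using Gamma_integral_complex'[OF s] by (auto simp: has_integral_iff)
  have re: "integrable lborel (\<lambda>u. Re (?f u))" "(\<integral>u. Re (?f u) \<partial>lborel) = Re (Gamma s)"
    using part[OF bounded_linear_Re] G integral_linear[OF G(2) bounded_linear_Re] by (auto simp: o_def)
  have im: "integrable lborel (\<lambda>u. Im (?f u))" "(\<integral>u. Im (?f u) \<partial>lborel) = Im (Gamma s)"
    using part[OF bounded_linear_Im] G integral_linear[OF G(2) bounded_linear_Im] by (auto simp: o_def)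
  have eq: "?f = (\<lambda>u. complex_of_real (Re (?f u)) + \<i> * complex_of_real (Im (?f u)))"
    by (rule ext) (simp add: complex_eq_iff)
  show int: "integrable lborel ?f"
    by (subst eq) (intro Bochner_Integration.integrable_add integrable_mult_right integrable_of_real re im)
  show "(\<integral>u. ?f u \<partial>lborel) = Gamma s"
    using integral_Re[OF int] integral_Im[OF int] re im by (simp only: complex_eq_iff)
qed

text \<open>The factor \<open>m\<close> is a translation of \<open>u\<close> by \<open>ln m\<close>,
  which pulls out the power of \<open>m\<close>.\<close>

lemma
  assumes s: "Re s > 0" and m: "m > 0"
  shows Gamma_exp_integrable: "integrable lborel (\<lambda>u. exp (s * of_real u) * complex_of_real (exp (- m * exp u)))"
    and Gamma_exp_integral: "(\<integral>u. exp (s * of_real u) * complex_of_real (exp (- m * exp u)) \<partial>lborel) =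
       Gamma s * complex_of_real m powr (- s)"
proof -
  let ?f = "\<lambda>u. exp (s * of_real u) * complex_of_real (exp (- exp u))"
  have eq: "exp (s * of_real u) * complex_of_real (exp (- m * exp u)) =
     complex_of_real m powr (- s) * ?f (ln m + 1 * u)" for u
  proof -
    have "exp (ln m + 1 * u) = m * exp u" using m by (simp add: exp_add)
    moreover have "complex_of_real m powr (- s) * exp (s * of_real (ln m + 1 * u)) = exp (s * of_real u)"
      using m by (simp add: powr_def Ln_of_real algebra_simps flip: exp_add)
    ultimately show ?thesis by (metis mult.assoc mult_minus_left)
  qed
  show "integrable lborel (\<lambda>u. exp (s * of_real u) * complex_of_real (exp (- m * exp u)))"
    unfolding eq by (intro integrable_mult_right lborel_integrable_real_affine[OF Gamma_exp_integrable_1[OF s]]) simp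
  have "(\<integral>u. ?f (ln m + 1 * u) \<partial>lborel) = Gamma s"
    using lborel_integral_real_affine[of 1 ?f "ln m"] Gamma_exp_integral_1[OF s] by simp
  thus "(\<integral>u. exp (s * of_real u) * complex_of_real (exp (- m * exp u)) \<partial>lborel) =
       Gamma s * complex_of_real m powr (- s)"
    unfolding eq by simp
qed

text \<open>The norms of the integrands add up to \<open>exp (Re s * u) * \<Theta> u\<close>, whose
  integral bounds every partial sum of the integrated norms. This permits the exchange of sum and
  integral, and it makes the enumerated series converge absolutely, as the unordered sum over
  \<open>I\<close> demands.\<close>

lemma infsum_powr_mellin:
  fixes \<mu> :: "'a \<Rightarrow> real"
  assumes I: "countable I" "infinite I" and pos: "\<And>k. k \<in> I \<Longrightarrow> \<mu> k > 0"
    and sum: "\<And>u. ((\<lambda>k. exp (- \<mu> k * exp u)) has_sum \<Theta> u) I"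
    and s: "Re s > 0"
    and int: "integrable lborel (\<lambda>u. exp (Re s * u) * \<Theta> u)"
  shows "Gamma s * (\<Sum>\<^sub>\<infinity>k\<in>I. complex_of_real (\<mu> k) powr (- s)) =
      (\<integral>u. exp (s * of_real u) * complex_of_real (\<Theta> u) \<partial>lborel)"
proof -
  define b where "b = from_nat_into I"
  have b: "bij_betw b UNIV I" unfolding b_def by (rule bij_betw_from_nat_into[OF I])
  have bI: "b n \<in> I" for n using b by (auto simp: bij_betw_def)
  define f where "f n u = exp (s * of_real u) * complex_of_real (exp (- \<mu> (b n) * exp u))" for n u
  have f_int: "integrable lborel (f n)" for n
    unfolding f_def by (rule Gamma_exp_integrable[OF s pos[OF bI]])
  have sums: "(\<lambda>n. exp (- \<mu> (b n) * exp u)) sums \<Theta> u" for u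
  proof -
    have "((\<lambda>n. exp (- \<mu> (b n) * exp u)) has_sum \<Theta> u) UNIV"
      using sum[of u] by (subst has_sum_reindex_bij_betw[OF b])
    thus ?thesis by (rule has_sum_imp_sums)
  qed
  have sums1: "(\<lambda>n. f n u) sums (exp (s * of_real u) * complex_of_real (\<Theta> u))" for u
    unfolding f_def by (intro sums_mult sums_of_real sums)
  have sums2: "(\<lambda>n. norm (f n u)) sums (exp (Re s * u) * \<Theta> u)" for u
    using sums_mult[OF sums[of u], of "exp (Re s * u)"] unfolding f_def by (simp add: norm_mult)
  have summ: "summable (\<lambda>n. \<integral>u. norm (f n u) \<partial>lborel)"
  proof (rule summableI_nonneg_bounded)
    fix n
    have "(\<Sum>k<n. \<integral>u. norm (f k u) \<partial>lborel) = (\<integral>u. (\<Sum>k<n. norm (f k u)) \<partial>lborel)"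
      by (intro Bochner_Integration.integral_sum[symmetric] integrable_norm f_int)
    also have "\<dots> \<le> (\<integral>u. exp (Re s * u) * \<Theta> u \<partial>lborel)"
      by (intro integral_mono int Bochner_Integration.integrable_sum integrable_norm f_int)
         (use sum_le_suminf[OF sums_summable[OF sums2]] sums_unique[OF sums2] in auto)
    finally show "(\<Sum>k<n. \<integral>u. norm (f k u) \<partial>lborel) \<le> (\<integral>u. exp (Re s * u) * \<Theta> u \<partial>lborel)" .
  qed auto
  have "(\<lambda>n. \<integral>u. f n u \<partial>lborel) sums (\<integral>u. (\<Sum>n. f n u) \<partial>lborel)"
    by (rule sums_integral[OF f_int _ summ]) (use sums2 in \<open>auto intro: sums_summable\<close>)
  also have "(\<lambda>u. \<Sum>n. f n u) = (\<lambda>u. exp (s * of_real u) * complex_of_real (\<Theta> u))"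
    using sums_unique[OF sums1] by (intro ext) simp
  also have "(\<lambda>n. \<integral>u. f n u \<partial>lborel) = (\<lambda>n. Gamma s * complex_of_real (\<mu> (b n)) powr (- s))"
    unfolding f_def by (intro ext Gamma_exp_integral[OF s pos[OF bI]])
  finally have *: "(\<lambda>n. Gamma s * complex_of_real (\<mu> (b n)) powr (- s)) sums
     (\<integral>u. exp (s * of_real u) * complex_of_real (\<Theta> u) \<partial>lborel)" .
  have "summable (\<lambda>n. norm (Gamma s * complex_of_real (\<mu> (b n)) powr (- s)))"
  proof (rule summable_comparison_test'[OF summ])
    fix n
    have "Gamma s * complex_of_real (\<mu> (b n)) powr (- s) = (\<integral>u. f n u \<partial>lborel)"
      unfolding f_def by (rule Gamma_exp_integral[OF s pos[OF bI], symmetric])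
    thus "norm (norm (Gamma s * complex_of_real (\<mu> (b n)) powr (- s))) \<le> (\<integral>u. norm (f n u) \<partial>lborel)"
      by simp
  qed
  from norm_summable_imp_has_sum[OF this *]
  have "((\<lambda>k. Gamma s * complex_of_real (\<mu> k) powr (- s)) has_sum
     (\<integral>u. exp (s * of_real u) * complex_of_real (\<Theta> u) \<partial>lborel)) I"
    by (subst (asm) has_sum_reindex_bij_betw[OF b])
  from infsumI[OF this] show ?thesis by (simp only: infsum_cmult_right')
qed

subsection \<open>Heat trace and zeta function of the box\<close>

lemma jtheta_has_sum:
  assumes "x > 0"
  shows "((\<lambda>k::nat. exp (- (pi * (real k)\<^sup>2 * x))) has_sum (1 + jtheta x) / 2) UNIV"
proof -
  have "(\<lambda>k. exp (- (pi * (real (Suc k))\<^sup>2 * x))) sums ((1 + jtheta x) / 2 - 1)"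
    using summable_sums[OF summable_jtheta[OF assms]] by (simp only: jtheta_def) (simp add: add_divide_distrib)
  hence "(\<lambda>k. exp (- (pi * (real k)\<^sup>2 * x))) sums ((1 + jtheta x) / 2 - 1 + exp (- (pi * (real 0)\<^sup>2 * x)))"
    by (rule sums_Suc)
  moreover have "(1 + jtheta x) / 2 - 1 + exp (- (pi * (real 0)\<^sup>2 * x)) = (1 + jtheta x) / 2"
    by (simp add: add_divide_distrib)
  ultimately show ?thesis by (intro sums_nonneg_imp_has_sum) (simp_all only: exp_ge_zero)
qed

text \<open>The distributive law for infinite sums, by splitting off one coordinate at a time.
  Nonnegativity makes the double sums absolutely summable.\<close>

lemma has_sum_prod_PiE_nonneg:
  fixes f :: "'a \<Rightarrow> 'b \<Rightarrow> real"
  assumes "finite A" and "\<And>x. x \<in> A \<Longrightarrow> (f x has_sum S x) (B x)"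
    and "\<And>x y. x \<in> A \<Longrightarrow> y \<in> B x \<Longrightarrow> f x y \<ge> 0"
  shows "((\<lambda>g. \<Prod>x\<in>A. f x (g x)) has_sum (\<Prod>x\<in>A. S x)) (PiE A B)"
  using assms
proof (induction A rule: finite_induct)
  case empty
  show ?case by (simp add: has_sum_finite_iff)
next
  case (insert x A)
  have IH: "((\<lambda>g. \<Prod>x\<in>A. f x (g x)) has_sum (\<Prod>x\<in>A. S x)) (PiE A B)"
    using insert by blast
  have fx: "(f x has_sum S x) (B x)" using insert by blast
  have nn: "0 \<le> (\<Prod>x\<in>A. f x (g x))" if "g \<in> PiE A B" for g
    using that insert.prems by (intro prod_nonneg) (auto simp: PiE_iff)
  have bij: "bij_betw (\<lambda>(y, g). g(x := y)) (B x \<times> PiE A B) (PiE (insert x A) B)"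
    unfolding PiE_insert_eq using inj_combinator[OF insert.hyps(2)] by (simp add: bij_betw_def)
  have "((\<lambda>(y, g). f x y * (\<Prod>x\<in>A. f x (g x))) has_sum (S x * (\<Prod>x\<in>A. S x))) (B x \<times> PiE A B)"
  proof (rule has_sum_SigmaI)
    show "((\<lambda>g. (\<lambda>(y, g). f x y * (\<Prod>x\<in>A. f x (g x))) (y, g)) has_sum f x y * (\<Prod>x\<in>A. S x)) (PiE A B)" for y
      using has_sum_cmult_right[OF IH] by simp
    show "((\<lambda>y. f x y * (\<Prod>x\<in>A. S x)) has_sum (S x * (\<Prod>x\<in>A. S x))) (B x)"
      by (rule has_sum_cmult_left[OF fx])
    have "(\<lambda>p. norm ((\<lambda>(y, g). f x y * (\<Prod>x\<in>A. f x (g x))) p)) summable_on B x \<times> PiE A B"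
    proof (subst Infinite_Sum.abs_summable_on_Sigma_iff, intro conjI ballI)
      fix y assume y: "y \<in> B x"
      have "(\<lambda>g. f x y * (\<Prod>x\<in>A. f x (g x))) summable_on PiE A B"
        using has_sum_cmult_right[OF IH] by (auto simp: summable_on_def)
      thus "(\<lambda>g. norm ((\<lambda>(y, g). f x y * (\<Prod>x\<in>A. f x (g x))) (y, g))) summable_on PiE A B"
        using nn y insert.prems by (subst summable_on_cong[where g = "\<lambda>g. f x y * (\<Prod>x\<in>A. f x (g x))"]) auto
    next
      have eq: "norm (infsum (\<lambda>g. norm ((\<lambda>(y, g). f x y * (\<Prod>x\<in>A. f x (g x))) (y, g))) (PiE A B)) = f x y * (\<Prod>x\<in>A. S x)"
        if y: "y \<in> B x" for y
      proof -
        have "infsum (\<lambda>g. norm ((\<lambda>(y, g). f x y * (\<Prod>x\<in>A. f x (g x))) (y, g))) (PiE A B) =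
          infsum (\<lambda>g. f x y * (\<Prod>x\<in>A. f x (g x))) (PiE A B)"
          using nn y insert.prems by (intro infsum_cong) auto
        also have "\<dots> = f x y * (\<Prod>x\<in>A. S x)" by (rule infsumI[OF has_sum_cmult_right[OF IH]])
        finally show ?thesis using y insert.prems has_sum_nonneg[OF IH nn] by simp
      qed
      have "(\<lambda>y. f x y * (\<Prod>x\<in>A. S x)) summable_on B x"
        using has_sum_cmult_left[OF fx] by (auto simp: summable_on_def)
      thus "(\<lambda>y. norm (infsum (\<lambda>g. norm ((\<lambda>(y, g). f x y * (\<Prod>x\<in>A. f x (g x))) (y, g))) (PiE A B))) summable_on B x"
        by (subst summable_on_cong[OF eq])
    qed
    thus "(\<lambda>(y, g). f x y * (\<Prod>x\<in>A. f x (g x))) summable_on B x \<times> PiE A B"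
      by (rule Infinite_Sum.abs_summable_summable)
  qed
  also have "(\<lambda>(y, g). f x y * (\<Prod>x\<in>A. f x (g x))) =
      (\<lambda>p. \<Prod>z\<in>insert x A. f z ((case p of (y, g) \<Rightarrow> g(x := y)) z))"
  proof (rule ext, clarify)
    fix y g
    have "(\<Prod>z\<in>A. f z ((g(x := y)) z)) = (\<Prod>z\<in>A. f z (g z))"
      using insert.hyps by (intro prod.cong) auto
    thus "f x y * (\<Prod>x\<in>A. f x (g x)) = (\<Prod>z\<in>insert x A. f z ((g(x := y)) z))"
      using insert.hyps by simp
  qed
  finally have "((\<lambda>p. \<Prod>z\<in>insert x A. f z ((case p of (y, g) \<Rightarrow> g(x := y)) z)) has_sum (S x * (\<Prod>x\<in>A. S x))) (B x \<times> PiE A B)" .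
  hence "((\<lambda>g. \<Prod>z\<in>insert x A. f z (g z)) has_sum (S x * (\<Prod>x\<in>A. S x))) (PiE (insert x A) B)"
    by (subst (asm) has_sum_reindex_bij_betw[OF bij])
  thus ?case using insert.hyps by simp
qed

text \<open>Dividing the eigenvalues by \<open>pi\<close> brings the factors into the normalization
  of \<open>jtheta\<close>, in which the functional equation is clean. The factor
  \<open>pi powr (- s)\<close> in \<open>box_zeta\<close> restores the scale.\<close>

lemma box_heat_trace:
  fixes q :: "real ^ 'n"
  assumes q: "\<And>j. q $ j > 0"
  shows "((\<lambda>k. exp (- (neumann_eigenvalue q k / pi) * exp u)) has_sum
      ((\<Prod>j\<in>UNIV. (1 + jtheta (exp u / (q $ j)\<^sup>2)) / 2) - 1)) {k. k \<noteq> 0}"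
proof -
  define \<Theta> where "\<Theta> = (\<Prod>j\<in>UNIV. (1 + jtheta (exp u / (q $ j)\<^sup>2)) / 2)"
  have qu: "exp u / (q $ j)\<^sup>2 > 0" for j using q[of j] by simp
  let ?f = "\<lambda>j k. exp (- (pi * (real k)\<^sup>2 * (exp u / (q $ j)\<^sup>2)))"
  have "((\<lambda>g. \<Prod>j\<in>UNIV. ?f j (g j)) has_sum \<Theta>) (PiE UNIV (\<lambda>_. UNIV))"
    unfolding \<Theta>_def by (rule has_sum_prod_PiE_nonneg) (simp_all only: exp_ge_zero finite_class.finite_UNIV jtheta_has_sum[OF qu])
  hence "((\<lambda>g. \<Prod>j\<in>UNIV. ?f j (g j)) has_sum \<Theta>) UNIV" by (simp add: PiE_UNIV_domain)
  moreover have bij: "bij_betw (\<lambda>k j. k $ j) (UNIV :: (nat ^ 'n) set) UNIV"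
    by (rule bij_betwI[of _ _ _ "\<lambda>g. \<chi> j. g j"]) auto
  ultimately have "((\<lambda>k::nat ^ 'n. \<Prod>j\<in>UNIV. ?f j (k $ j)) has_sum \<Theta>) UNIV"
    by (subst (asm) has_sum_reindex_bij_betw[OF bij, symmetric])
  also have "(\<lambda>k::nat ^ 'n. \<Prod>j\<in>UNIV. ?f j (k $ j)) = (\<lambda>k. exp (- (neumann_eigenvalue q k / pi) * exp u))"
  proof
    fix k :: "nat ^ 'n"
    have "(\<Prod>j\<in>UNIV. ?f j (k $ j)) = exp (\<Sum>j\<in>UNIV. - (pi * (real (k $ j))\<^sup>2 * (exp u / (q $ j)\<^sup>2)))"
      by (simp add: exp_sum)
    also have "(\<Sum>j\<in>UNIV. - (pi * (real (k $ j))\<^sup>2 * (exp u / (q $ j)\<^sup>2))) = - (neumann_eigenvalue q k / pi) * exp u"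
    proof -
      have "neumann_eigenvalue q k / pi = pi * (\<Sum>j\<in>UNIV. (real (k $ j))\<^sup>2 / (q $ j)\<^sup>2)"
        by (simp add: neumann_eigenvalue_def power2_eq_square)
      thus ?thesis by (simp add: sum_distrib_left sum_distrib_right sum_negf mult_ac)
    qed
    finally show "(\<Prod>j\<in>UNIV. ?f j (k $ j)) = exp (- (neumann_eigenvalue q k / pi) * exp u)" .
  qed
  finally have all: "((\<lambda>k. exp (- (neumann_eigenvalue q k / pi) * exp u)) has_sum \<Theta>) UNIV" .
  have one: "((\<lambda>k. exp (- (neumann_eigenvalue q k / pi) * exp u)) has_sum 1) {0}"
    by (simp add: has_sum_finite_iff neumann_eigenvalue_def)
  have "((\<lambda>k. exp (- (neumann_eigenvalue q k / pi) * exp u)) has_sum (\<Theta> - 1)) (UNIV - {0})"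
    by (rule has_sum_Diff[OF all one]) auto
  moreover have "UNIV - {0} = {k :: nat ^ 'n. k \<noteq> 0}" by auto
  ultimately show ?thesis by (simp add: \<Theta>_def)
qed

text \<open>The single zero mode is shared out among all \<open>2 ^ card A\<close> subsets, so every
  torus loses its own zero mode and has a convergent Mellin integral. The empty set then contributes
  nothing.\<close>

lemma prod_half_expand:
  fixes x :: "'a \<Rightarrow> real"
  assumes "finite A"
  shows "(\<Prod>j\<in>A. (1 + x j) / 2) - 1 = (1 / 2 ^ card A) * (\<Sum>S\<in>Pow A - {{}}. (\<Prod>j\<in>S. x j) - 1)"
proof -
  have "(\<Prod>j\<in>A. (1 + x j) / 2) = (\<Prod>j\<in>A. x j + 1) / 2 ^ card A"
    by (simp add: prod_dividef add.commute)
  also have "(\<Prod>j\<in>A. x j + 1) = (\<Sum>S\<in>Pow A. \<Prod>j\<in>S. x j)"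
    using prod_add[OF assms, of x "\<lambda>_. 1"] by simp
  also have "\<dots> = (\<Sum>S\<in>Pow A. (\<Prod>j\<in>S. x j) - 1) + 2 ^ card A"
    using assms by (simp add: sum_subtractf card_Pow)
  also have "(\<Sum>S\<in>Pow A. (\<Prod>j\<in>S. x j) - 1) = (\<Sum>S\<in>Pow A - {{}}. (\<Prod>j\<in>S. x j) - 1)"
    using assms by (intro sum.mono_neutral_right) auto
  finally show ?thesis by (simp add: add_divide_distrib)
qed

section \<open>Decay and reflection of theta products\<close>

lemma jtheta_measurable [measurable]: "jtheta \<in> borel_measurable borel"
  unfolding jtheta_def[abs_def] by measurable

lemma jtheta_minus_one_decay:
  assumes "0 < c" "c \<le> x"
  shows "0 \<le> jtheta x - 1" "jtheta x - 1 \<le> exp (- pi * (x - c)) * (jtheta c - 1)"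
proof -
  have x: "x > 0" using assms by simp
  have "0 \<le> (\<Sum>k. exp (- (pi * (real (Suc k))\<^sup>2 * x)))"
    by (intro suminf_nonneg summable_jtheta x) simp
  thus "0 \<le> jtheta x - 1" by (simp add: jtheta_def)
  have "(\<Sum>k. exp (- (pi * (real (Suc k))\<^sup>2 * x))) \<le> (\<Sum>k. exp (- pi * (x - c)) * exp (- (pi * (real (Suc k))\<^sup>2 * c)))"
  proof (rule suminf_le)
    fix k
    have "1 * (x - c) \<le> (real (Suc k))\<^sup>2 * (x - c)"
      using assms by (intro mult_right_mono) auto
    hence "pi * (x - c) \<le> pi * ((real (Suc k))\<^sup>2 * (x - c))" by simp
    hence "- (pi * (real (Suc k))\<^sup>2 * x) \<le> - pi * (x - c) + - (pi * (real (Suc k))\<^sup>2 * c)"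
      by (simp add: algebra_simps)
    thus "exp (- (pi * (real (Suc k))\<^sup>2 * x)) \<le> exp (- pi * (x - c)) * exp (- (pi * (real (Suc k))\<^sup>2 * c))"
      by (simp only: exp_add[symmetric] exp_le_cancel_iff)
  qed (intro summable_jtheta summable_mult x assms)+
  also have "\<dots> = exp (- pi * (x - c)) * (\<Sum>k. exp (- (pi * (real (Suc k))\<^sup>2 * c)))"
    by (intro suminf_mult summable_jtheta assms)
  finally show "jtheta x - 1 \<le> exp (- pi * (x - c)) * (jtheta c - 1)"
    by (simp add: jtheta_def)
qed

lemma rapid_add: "rapid v \<Longrightarrow> rapid w \<Longrightarrow> rapid (\<lambda>u. v u + w u)"
proof -
  assume v: "rapid v" and w: "rapid w"
  have "\<exists>K. \<forall>u\<ge>0. \<bar>v u + w u\<bar> \<le> K * exp (- a * u)" for a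
  proof -
    obtain K L where "\<And>u. u \<ge> 0 \<Longrightarrow> \<bar>v u\<bar> \<le> K * exp (- a * u)" "\<And>u. u \<ge> 0 \<Longrightarrow> \<bar>w u\<bar> \<le> L * exp (- a * u)"
      using rapidE[OF v, of a] rapidE[OF w, of a] by metis
    hence "\<forall>u\<ge>0. \<bar>v u + w u\<bar> \<le> (K + L) * exp (- a * u)"
      by (auto simp: distrib_right intro: order_trans[OF abs_triangle_ineq] add_mono)
    thus ?thesis by blast
  qed
  thus ?thesis using rapid_measurable[OF v] rapid_measurable[OF w] by (simp add: rapid_def)
qed

lemma rapid_mult: "rapid v \<Longrightarrow> rapid w \<Longrightarrow> rapid (\<lambda>u. v u * w u)"
proof -
  assume v: "rapid v" and w: "rapid w"
  have "\<exists>K. \<forall>u\<ge>0. \<bar>v u * w u\<bar> \<le> K * exp (- a * u)" for a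
  proof -
    obtain K where K: "K \<ge> 0" "\<And>u. u \<ge> 0 \<Longrightarrow> \<bar>v u\<bar> \<le> K * exp (- a * u)"
      using rapidE[OF v, of a] by metis
    obtain L where L: "L \<ge> 0" "\<And>u. u \<ge> 0 \<Longrightarrow> \<bar>w u\<bar> \<le> L * exp (- 0 * u)"
      using rapidE[OF w, of 0] by metis
    have "\<bar>v u * w u\<bar> \<le> (K * L) * exp (- a * u)" if "u \<ge> 0" for u
      using mult_mono[OF K(2)[OF that] L(2)[OF that]] K L by (simp add: abs_mult mult_ac)
    thus ?thesis by blast
  qed
  thus ?thesis using rapid_measurable[OF v] rapid_measurable[OF w] by (simp add: rapid_def)
qed

lemma rapid_jtheta:
  assumes c: "c > 0"
  shows "rapid (\<lambda>u. jtheta (exp u * c) - 1)"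
  unfolding rapid_def
proof (intro conjI allI)
  show "(\<lambda>u. jtheta (exp u * c) - 1) \<in> borel_measurable borel" by measurable
  fix a :: real
  \<comment> \<open>After \<open>exp u - 1\<close> is bounded below by \<open>u^2 / 2\<close>,
    completing the square in \<open>pi * c * u^2 / 2 - a * u\<close> produces this exponent.\<close>
  define K where "K = exp (a\<^sup>2 / (2 * pi * c)) * (jtheta c - 1)"
  have "\<bar>jtheta (exp u * c) - 1\<bar> \<le> K * exp (- a * u)" if u: "u \<ge> 0" for u
  proof -
    have "1 \<le> exp u" using u by simp
    hence le: "c \<le> exp u * c" using c by simp
    note decay = jtheta_minus_one_decay[OF c le]
    have "exp u \<ge> 1 + u\<^sup>2 / 2" using exp_lower_Taylor_quadratic[OF u] u by simp
    hence "pi * c * (exp u - 1) \<ge> pi * c * (u\<^sup>2 / 2)" using c by (intro mult_left_mono) auto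
    moreover have "pi * c * (u\<^sup>2 / 2) - a * u + a\<^sup>2 / (2 * pi * c) = (pi * c * u - a)\<^sup>2 / (2 * pi * c)"
      using c by (simp add: power2_eq_square field_simps)
    hence "pi * c * (u\<^sup>2 / 2) - a * u + a\<^sup>2 / (2 * pi * c) \<ge> 0" using c by simp
    ultimately have "- pi * (exp u * c - c) \<le> a\<^sup>2 / (2 * pi * c) + - a * u"
      by (simp add: algebra_simps)
    hence "exp (- pi * (exp u * c - c)) \<le> exp (a\<^sup>2 / (2 * pi * c)) * exp (- a * u)"
      by (simp only: exp_add[symmetric] exp_le_cancel_iff)
    hence "exp (- pi * (exp u * c - c)) * (jtheta c - 1) \<le> exp (a\<^sup>2 / (2 * pi * c)) * exp (- a * u) * (jtheta c - 1)"
      using jtheta_minus_one_decay(1)[OF c order_refl] by (rule mult_right_mono)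
    with decay show ?thesis by (simp add: K_def mult_ac)
  qed
  thus "\<exists>K. \<forall>u\<ge>0. \<bar>jtheta (exp u * c) - 1\<bar> \<le> K * exp (- a * u)" by blast
qed

definition theta_prod :: "'a set \<Rightarrow> ('a \<Rightarrow> real) \<Rightarrow> real \<Rightarrow> real" where
  "theta_prod S c u = (\<Prod>j\<in>S. jtheta (exp u * c j))"

lemma rapid_theta_prod:
  assumes "finite S" "\<And>j. j \<in> S \<Longrightarrow> c j > 0"
  shows "rapid (\<lambda>u. theta_prod S c u - 1)"
  using assms
proof (induction S rule: finite_induct)
  case empty
  show ?case by (auto simp: theta_prod_def rapid_def intro: exI[of _ 0])
next
  case (insert x S)
  have 1: "rapid (\<lambda>u. jtheta (exp u * c x) - 1)" using insert by (intro rapid_jtheta) auto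
  have 2: "rapid (\<lambda>u. theta_prod S c u - 1)" using insert by auto
  have "(\<lambda>u. theta_prod (insert x S) c u - 1) = (\<lambda>u. (jtheta (exp u * c x) - 1) * (theta_prod S c u - 1) +
      ((jtheta (exp u * c x) - 1) + (theta_prod S c u - 1)))"
    using insert.hyps by (auto simp: theta_prod_def algebra_simps)
  thus ?case using rapid_add[OF rapid_mult[OF 1 2] rapid_add[OF 1 2]] by simp
qed

text \<open>The functional equation gives each factor a multiplier
  \<open>exp (u / 2) * sqrt (1 / c j)\<close>. The roots cancel because the \<open>c j\<close> have
  product one, which is the purpose of normalizing the volume.\<close>

lemma theta_prod_reflect:
  assumes fin: "finite S" and pos: "\<And>j. j \<in> S \<Longrightarrow> c j > 0" and prod1: "prod c S = 1"
  shows "theta_prod S c (- u) = exp (real (card S) / 2 * u) * theta_prod S (\<lambda>j. 1 / c j) u"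
proof -
  have half: "sqrt (exp u) = exp (u / 2)"
    by (rule real_sqrt_unique) (simp_all flip: exp_of_nat_mult)
  have "theta_prod S c (- u) = (\<Prod>j\<in>S. exp (u / 2) * sqrt (1 / c j) * jtheta (exp u * (1 / c j)))"
    unfolding theta_prod_def
  proof (rule prod.cong)
    fix j assume j: "j \<in> S"
    have "exp (- u) * c j = 1 / (exp u * (1 / c j))" using pos[OF j] by (simp add: exp_minus field_simps)
    thus "jtheta (exp (- u) * c j) = exp (u / 2) * sqrt (1 / c j) * jtheta (exp u * (1 / c j))"
      using jtheta_inverse[of "exp u * (1 / c j)"] pos[OF j] by (simp only: real_sqrt_mult half) simp
  qed simp
  also have "\<dots> = exp (u / 2) ^ card S * (\<Prod>j\<in>S. sqrt (1 / c j)) * theta_prod S (\<lambda>j. 1 / c j) u"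
    by (simp add: prod.distrib theta_prod_def)
  also have "(\<Prod>j\<in>S. sqrt (1 / c j)) = sqrt (\<Prod>j\<in>S. 1 / c j)"
    using fin by (induction S rule: finite_induct) (simp_all add: real_sqrt_mult real_sqrt_divide)
  also have "(\<Prod>j\<in>S. 1 / c j) = 1" using prod1 by (simp add: prod_dividef)
  also have "exp (u / 2) ^ card S = exp (real (card S) / 2 * u)"
    by (simp flip: exp_of_nat_mult)
  finally show ?thesis by simp
qed

text \<open>
  \<open>exp (box_shift q S)\<close> is the square of the geometric mean of the sides in \<open>S\<close>, the factor that
  normalizes the torus of \<open>S\<close> to volume one.
\<close>

definition box_shift :: "real ^ 'n \<Rightarrow> 'n set \<Rightarrow> real" where
  "box_shift q S = 2 / real (card S) * (\<Sum>j\<in>S. ln (q $ j))"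

definition box_ratio :: "real ^ 'n \<Rightarrow> 'n set \<Rightarrow> 'n \<Rightarrow> real" where
  "box_ratio q S j = exp (box_shift q S) / (q $ j)\<^sup>2"

text \<open>The entire part of the Mellin transform of the normalized torus, its two poles removed.
  The reciprocal ratios in the second summand describe the dual torus.\<close>

definition box_regular :: "real ^ 'n \<Rightarrow> 'n set \<Rightarrow> complex \<Rightarrow> complex" where
  "box_regular q S s = laplace (\<lambda>u. theta_prod S (box_ratio q S) u - 1) s +
     laplace (\<lambda>u. theta_prod S (\<lambda>j. 1 / box_ratio q S j) u - 1) (of_real (real (card S) / 2) - s)"

text \<open>
  The pole term \<open>- rGamma s / s\<close> is written \<open>- rGamma (s + 1)\<close>, which avoids the junk value at \<open>s = 0\<close>.
  The junk values at the poles \<open>s = d / 2\<close> are removed later by \<open>remove_sings\<close>.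
\<close>

definition box_zeta :: "real ^ 'n \<Rightarrow> complex \<Rightarrow> complex" where
  "box_zeta q s = complex_of_real pi powr (- s) * ((1 / 2 ^ CARD('n)) *
     (\<Sum>S\<in>Pow UNIV - {{}}. exp (s * of_real (box_shift q S)) *
        (rGamma s * (box_regular q S s + 1 / (s - of_real (real (card S) / 2))) - rGamma (s + 1))))"

lemma box_ratio_pos: "(\<And>j. q $ j > 0) \<Longrightarrow> box_ratio q S j > 0"
  unfolding box_ratio_def by (metis divide_pos_pos exp_gt_zero zero_less_power)

lemma box_ratio_prod:
  fixes q :: "real ^ 'n"
  assumes q: "\<And>j. q $ j > 0" and S: "S \<noteq> {}"
  shows "prod (box_ratio q S) S = 1"
proof -
  have "prod (box_ratio q S) S = (\<Prod>j\<in>S. exp (box_shift q S - 2 * ln (q $ j)))"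
  proof (rule prod.cong)
    fix j
    have "exp (2 * ln (q $ j)) = (q $ j)\<^sup>2" using q[of j]
      by (metis exp_double exp_ln)
    thus "box_ratio q S j = exp (box_shift q S - 2 * ln (q $ j))" by (simp add: box_ratio_def exp_diff)
  qed simp
  also have "\<dots> = exp (\<Sum>j\<in>S. box_shift q S - 2 * ln (q $ j))" by (simp add: exp_sum)
  also have "(\<Sum>j\<in>S. box_shift q S - 2 * ln (q $ j)) = 0"
    using S by (simp add: box_shift_def sum_subtractf card_gt_0_iff flip: sum_distrib_left)
  finally show ?thesis by simp
qed

text \<open>Normalizing the torus is a translation of \<open>u\<close> by
  \<open>box_shift q S\<close>, and its price is the exponential factor.\<close>

lemma
  fixes q :: "real ^ 'n"
  assumes q: "\<And>j. q $ j > 0" and S: "S \<noteq> {}" and s: "Re s > real (card S) / 2"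
  shows face_mellin_integrable:
      "integrable lborel (\<lambda>u. exp (s * of_real u) * complex_of_real ((\<Prod>j\<in>S. jtheta (exp u / (q $ j)\<^sup>2)) - 1))"
    and face_mellin_integral:
      "(\<integral>u. exp (s * of_real u) * complex_of_real ((\<Prod>j\<in>S. jtheta (exp u / (q $ j)\<^sup>2)) - 1) \<partial>lborel) =
       exp (s * of_real (box_shift q S)) * (box_regular q S s + 1 / (s - of_real (real (card S) / 2)) - 1 / s)"
proof -
  define b where "b = box_shift q S"
  define P where "P = theta_prod S (box_ratio q S)"
  define Q where "Q = theta_prod S (\<lambda>j. 1 / box_ratio q S j)"
  have fin: "finite S" by simp
  have cpos: "box_ratio q S j > 0" for j using q by (rule box_ratio_pos)
  have P: "rapid (\<lambda>u. P u - 1)" unfolding P_def by (intro rapid_theta_prod fin cpos)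
  have Q: "rapid (\<lambda>u. Q u - 1)" unfolding Q_def by (intro rapid_theta_prod fin) (simp add: cpos)
  have refl: "P (- u) = exp (real (card S) / 2 * u) * Q u" for u
    unfolding P_def Q_def by (intro theta_prod_reflect fin cpos box_ratio_prod q S)
  have a: "real (card S) / 2 > 0" using S by (simp add: card_gt_0_iff)
  let ?f = "\<lambda>u. exp (s * of_real u) * complex_of_real (P u - 1)"
  have eq: "exp (s * of_real u) * complex_of_real ((\<Prod>j\<in>S. jtheta (exp u / (q $ j)\<^sup>2)) - 1) =
     exp (s * of_real b) * ?f (- b + 1 * u)" for u
  proof -
    have "P (- b + 1 * u) = (\<Prod>j\<in>S. jtheta (exp u / (q $ j)\<^sup>2))"
      unfolding P_def theta_prod_def
    proof (intro prod.cong refl arg_cong[of _ _ jtheta])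
      fix j
      have "exp (- b + 1 * u) * exp b = exp u" by (simp flip: exp_add)
      thus "exp (- b + 1 * u) * box_ratio q S j = exp u / (q $ j)\<^sup>2"
        by (simp add: box_ratio_def b_def)
    qed simp
    moreover have "exp (s * of_real u) = exp (s * of_real b) * exp (s * of_real (- b + 1 * u))"
      by (simp add: algebra_simps flip: exp_add)
    ultimately show ?thesis by simp
  qed
  have int: "integrable lborel ?f" by (rule mellin_integrable[OF P Q refl a s])
  show "integrable lborel (\<lambda>u. exp (s * of_real u) * complex_of_real ((\<Prod>j\<in>S. jtheta (exp u / (q $ j)\<^sup>2)) - 1))"
    unfolding eq by (intro integrable_mult_right lborel_integrable_real_affine[OF int]) simp
  have "(\<integral>u. ?f (- b + 1 * u) \<partial>lborel) = (\<integral>u. ?f u \<partial>lborel)"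
    using lborel_integral_real_affine[of 1 ?f "- b"] by simp
  also have "\<dots> = box_regular q S s + 1 / (s - of_real (real (card S) / 2)) - 1 / s"
    by (subst mellin_integral[OF P Q refl a s]) (simp add: box_regular_def P_def Q_def)
  finally show "(\<integral>u. exp (s * of_real u) * complex_of_real ((\<Prod>j\<in>S. jtheta (exp u / (q $ j)\<^sup>2)) - 1) \<partial>lborel) =
       exp (s * of_real (box_shift q S)) * (box_regular q S s + 1 / (s - of_real (real (card S) / 2)) - 1 / s)"
    unfolding eq by (simp add: b_def)
qed

lemma neumann_eigenvalue_pos:
  fixes q :: "real ^ 'n"
  assumes q: "\<And>j. q $ j > 0" and k: "k \<noteq> 0"
  shows "neumann_eigenvalue q k > 0"
proof -
  obtain i where i: "k $ i \<noteq> 0" using k by (auto simp: vec_eq_iff)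
  have "0 < (real (k $ i))\<^sup>2 / (q $ i)\<^sup>2" using i q[of i] by simp
  also have "\<dots> \<le> (\<Sum>j\<in>UNIV. (real (k $ j))\<^sup>2 / (q $ j)\<^sup>2)"
    by (rule member_le_sum) auto
  finally show ?thesis by (simp add: neumann_eigenvalue_def)
qed

lemma infinite_nonzero_vec: "infinite {k :: nat ^ 'n. k \<noteq> 0}"
proof -
  have "inj (\<lambda>m. (\<chi> j. Suc m) :: nat ^ 'n)" by (auto simp: inj_def vec_eq_iff)
  moreover have "range (\<lambda>m. (\<chi> j. Suc m) :: nat ^ 'n) \<subseteq> {k. k \<noteq> 0}" by (auto simp: vec_eq_iff)
  ultimately show ?thesis by (meson finite_subset range_inj_infinite)
qed

lemma box_zeta_eq_series:
  fixes q :: "real ^ 'n"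
  assumes q: "\<And>j. q $ j > 0" and s: "Re s > real CARD('n) / 2"
  shows "box_zeta q s = neumann_zeta_series q s"
proof -
  define \<Theta> where "\<Theta> u = (\<Prod>j\<in>UNIV. (1 + jtheta (exp u / (q $ j)\<^sup>2)) / 2) - 1" for u
  define \<mu> where "\<mu> k = neumann_eigenvalue q k / pi" for k :: "nat ^ 'n"
  define E where "E S u = (\<Prod>j\<in>S. jtheta (exp u / (q $ j)\<^sup>2)) - 1" for S u
  have \<Theta>_eq: "\<Theta> u = (1 / 2 ^ CARD('n)) * (\<Sum>S\<in>Pow UNIV - {{}}. E S u)" for u
    unfolding \<Theta>_def E_def by (rule prod_half_expand) simp
  have s0: "Re s > 0" by (rule le_less_trans[OF _ s]) simp
  have sS: "Re s > real (card S) / 2" for S :: "'n set"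
    by (rule le_less_trans[OF _ s]) (simp add: card_mono)
  \<comment> \<open>Needed for \<open>s' = s\<close> and for \<open>s' = Re s\<close>, the latter
    for the domination hypothesis of \<open>infsum_powr_mellin\<close>.\<close>
  have int: "integrable lborel (\<lambda>u. exp (s' * of_real u) * complex_of_real (E S u))"
    if "S \<noteq> {}" "Re s' = Re s" for S s'
    unfolding E_def by (rule face_mellin_integrable[OF q that(1)]) (use sS[of S] that in simp)
  have int_\<Theta>: "integrable lborel (\<lambda>u. exp (Re s * u) * \<Theta> u)"
  proof -
    have "integrable lborel (\<lambda>u. exp (Re s * u) * E S u)" if "S \<noteq> {}" for S
      using integrable_Re[OF int[OF that, of "of_real (Re s)"]]
      by (simp add: exp_of_real flip: of_real_mult)
    hence "integrable lborel (\<lambda>u. (1 / 2 ^ CARD('n)) * (\<Sum>S\<in>Pow UNIV - {{}}. exp (Re s * u) * E S u))"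
      by (intro integrable_mult_right Bochner_Integration.integrable_sum) auto
    thus ?thesis unfolding \<Theta>_eq by (simp add: sum_distrib_left mult_ac)
  qed
  have "Gamma s * (\<Sum>\<^sub>\<infinity>k\<in>{k. k \<noteq> 0}. complex_of_real (\<mu> k) powr (- s)) =
      (\<integral>u. exp (s * of_real u) * complex_of_real (\<Theta> u) \<partial>lborel)"
  proof (rule infsum_powr_mellin)
    show "\<mu> k > 0" if "k \<in> {k. k \<noteq> 0}" for k
      using neumann_eigenvalue_pos[OF q, of k] that by (simp add: \<mu>_def)
    show "((\<lambda>k. exp (- \<mu> k * exp u)) has_sum \<Theta> u) {k. k \<noteq> 0}" for u
      unfolding \<mu>_def \<Theta>_def by (rule box_heat_trace[OF q])
  qed (use infinite_nonzero_vec s0 int_\<Theta> in auto)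
  also have "(\<lambda>u. exp (s * of_real u) * complex_of_real (\<Theta> u)) =
     (\<lambda>u. (1 / 2 ^ CARD('n)) * (\<Sum>S\<in>Pow UNIV - {{}}. exp (s * of_real u) * complex_of_real (E S u)))"
    unfolding \<Theta>_eq by (simp add: sum_distrib_left mult_ac)
  also have "(\<integral>u. (1 / 2 ^ CARD('n)) * (\<Sum>S\<in>Pow UNIV - {{}}. exp (s * of_real u) * complex_of_real (E S u)) \<partial>lborel) =
     (1 / 2 ^ CARD('n)) * (\<Sum>S\<in>Pow UNIV - {{}}. \<integral>u. exp (s * of_real u) * complex_of_real (E S u) \<partial>lborel)"
    by (subst integral_mult_right_zero, subst Bochner_Integration.integral_sum) (auto intro: int)
  also have "(\<Sum>S\<in>Pow UNIV - {{}}. \<integral>u. exp (s * of_real u) * complex_of_real (E S u) \<partial>lborel) =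
     (\<Sum>S\<in>Pow UNIV - {{}}. exp (s * of_real (box_shift q S)) *
        (box_regular q S s + 1 / (s - of_real (real (card S) / 2)) - 1 / s))"
    unfolding E_def by (intro sum.cong refl face_mellin_integral[OF q _ sS]) auto
  finally have G: "Gamma s * (\<Sum>\<^sub>\<infinity>k\<in>{k. k \<noteq> 0}. complex_of_real (\<mu> k) powr (- s)) = (1 / 2 ^ CARD('n)) *
     (\<Sum>S\<in>Pow UNIV - {{}}. exp (s * of_real (box_shift q S)) *
        (box_regular q S s + 1 / (s - of_real (real (card S) / 2)) - 1 / s))" .
  have "s \<notin> \<int>\<^sub>\<le>\<^sub>0" using s0 by (auto elim!: nonpos_Ints_cases)
  hence rG: "rGamma s * Gamma s = 1" by (simp add: Gamma_eq_zero_iff rGamma_inverse_Gamma)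
  have "s \<noteq> 0" using s0 by auto
  hence r1: "rGamma s * (x - 1 / s) = rGamma s * x - rGamma (s + 1)" for x
    using rGamma_plus1[of s] by (simp add: field_simps)
  have "(\<Sum>\<^sub>\<infinity>k\<in>{k. k \<noteq> 0}. complex_of_real (\<mu> k) powr (- s)) =
      rGamma s * (Gamma s * (\<Sum>\<^sub>\<infinity>k\<in>{k. k \<noteq> 0}. complex_of_real (\<mu> k) powr (- s)))"
    using rG by (simp flip: mult.assoc)
  also have "\<dots> = (1 / 2 ^ CARD('n)) * (\<Sum>S\<in>Pow UNIV - {{}}. exp (s * of_real (box_shift q S)) *
        (rGamma s * (box_regular q S s + 1 / (s - of_real (real (card S) / 2)) - 1 / s)))"
    unfolding G by (simp only: sum_distrib_left mult_ac)
  also have "\<dots> = (1 / 2 ^ CARD('n)) * (\<Sum>S\<in>Pow UNIV - {{}}. exp (s * of_real (box_shift q S)) *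
        (rGamma s * (box_regular q S s + 1 / (s - of_real (real (card S) / 2))) - rGamma (s + 1)))"
    by (simp only: r1)
  finally have sum_\<mu>: "box_zeta q s = complex_of_real pi powr (- s) * (\<Sum>\<^sub>\<infinity>k\<in>{k. k \<noteq> 0}. complex_of_real (\<mu> k) powr (- s))"
    by (simp only: box_zeta_def)
  have "neumann_zeta_series q s = (\<Sum>\<^sub>\<infinity>k\<in>{k. k \<noteq> 0}. complex_of_real pi powr (- s) * complex_of_real (\<mu> k) powr (- s))"
    unfolding neumann_zeta_series_def
  proof (rule infsum_cong)
    fix k :: "nat ^ 'n" assume "k \<in> {k. k \<noteq> 0}"
    hence p: "neumann_eigenvalue q k > 0" using neumann_eigenvalue_pos[OF q] by auto
    have "complex_of_real (neumann_eigenvalue q k) = of_real pi * of_real (\<mu> k)" by (simp add: \<mu>_def)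
    thus "complex_of_real (neumann_eigenvalue q k) powr (- s) = complex_of_real pi powr (- s) * complex_of_real (\<mu> k) powr (- s)"
      using p by (simp only:) (rule powr_times_real, auto simp: \<mu>_def)
  qed
  thus ?thesis unfolding sum_\<mu> by (simp only: infsum_cmult_right')
qed

lemma box_regular_holomorphic:
  fixes q :: "real ^ 'n"
  assumes q: "\<And>j. q $ j > 0"
  shows "box_regular q S holomorphic_on A"
proof -
  have cpos: "box_ratio q S j > 0" for j using q by (rule box_ratio_pos)
  have 1: "rapid (\<lambda>u. theta_prod S (box_ratio q S) u - 1)"
    by (intro rapid_theta_prod cpos) simp
  have 2: "rapid (\<lambda>u. theta_prod S (\<lambda>j. 1 / box_ratio q S j) u - 1)"
    by (intro rapid_theta_prod) (simp_all add: cpos)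
  have "(laplace (\<lambda>u. theta_prod S (\<lambda>j. 1 / box_ratio q S j) u - 1) \<circ> (\<lambda>s. of_real (real (card S) / 2) - s)) holomorphic_on A"
    by (rule holomorphic_on_compose[OF _ laplace_holomorphic[OF 2]]) (intro holomorphic_intros)
  with laplace_holomorphic[OF 1, of A] show ?thesis
    unfolding box_regular_def[abs_def] o_def by (intro holomorphic_intros)
qed

section \<open>Meromorphic continuation and its uniqueness\<close>

lemma box_zeta_meromorphic:
  fixes q :: "real ^ 'n"
  assumes q: "\<And>j. q $ j > 0"
  shows "box_zeta q meromorphic_on UNIV"
proof -
  have h: "f meromorphic_on UNIV" if "f holomorphic_on UNIV" for f
    using that by (intro analytic_on_imp_meromorphic_on) (simp add: analytic_on_open)
  have pi: "(\<lambda>s. complex_of_real pi powr (- s)) meromorphic_on UNIV"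
    using pi_gt_zero by (intro h holomorphic_intros) (simp add: not_le)
  have exp: "(\<lambda>s. exp (s * of_real b)) meromorphic_on UNIV" for b
    by (intro h holomorphic_intros)
  have rG: "(rGamma :: complex \<Rightarrow> complex) meromorphic_on UNIV"
    "(\<lambda>s::complex. rGamma (s + 1)) meromorphic_on UNIV"
    by (rule h, rule holomorphic_rGamma) (rule h, intro holomorphic_rGamma' holomorphic_intros)
  have 2: "box_regular q S meromorphic_on UNIV" for S
    by (rule h, rule box_regular_holomorphic[OF q])
  show ?thesis
    unfolding box_zeta_def[abs_def] by (intro meromorphic_intros pi exp rG 2)
qed

lemma box_zeta_analytic:
  fixes q :: "real ^ 'n"
  assumes q: "\<And>j. q $ j > 0" and s: "\<And>d. 1 \<le> d \<Longrightarrow> d \<le> CARD('n) \<Longrightarrow> s \<noteq> of_real (real d / 2)"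
  shows "box_zeta q analytic_on {s}"
proof -
  define U where "U = - ((\<lambda>d. complex_of_real (real d / 2)) ` {1..CARD('n)})"
  have "open U" unfolding U_def by (intro open_Compl finite_imp_closed) simp
  moreover have "s \<in> U"
  proof -
    have "s \<notin> (\<lambda>d. complex_of_real (real d / 2)) ` {1..CARD('n)}"
    proof
      assume "s \<in> (\<lambda>d. complex_of_real (real d / 2)) ` {1..CARD('n)}"
      then obtain d where "d \<in> {1..CARD('n)}" "s = complex_of_real (real d / 2)" by blast
      with s[of d] show False by (metis atLeastAtMost_iff)
    qed
    thus ?thesis by (simp only: U_def Compl_iff not_False_eq_True)
  qed
  moreover have "box_zeta q holomorphic_on U"
    unfolding box_zeta_def[abs_def]
  proof (intro holomorphic_intros holomorphic_rGamma holomorphic_rGamma' box_regular_holomorphic q)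
    fix S :: "'n set" and z assume S: "S \<in> Pow UNIV - {{}}" and z: "z \<in> U"
    have "card S \<in> {1..CARD('n)}" using S by (auto simp: Suc_le_eq card_gt_0_iff card_mono)
    with z show "z - complex_of_real (real (card S) / 2) \<noteq> 0" unfolding U_def by auto
  qed
  ultimately show ?thesis by (auto simp: analytic_at)
qed

lemma nicely_meromorphic_remove_sings:
  assumes "f nicely_meromorphic_on UNIV"
  shows "remove_sings f = f"
proof
  fix z
  have "is_pole f z \<and> f z = 0 \<or> f \<midarrow>z\<rightarrow> f z" using assms by (auto simp: nicely_meromorphic_on_def)
  thus "remove_sings f z = f z" by auto
qed

text \<open>A difference of nicely meromorphic functions can have the wrong value where poles
  cancel, so the identity theorem is applied to \<open>remove_sings\<close> of the difference. It
  yields equality in a punctured neighbourhood of each point, and nice meromorphy then fixes the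
  value at the point itself.\<close>

lemma nicely_meromorphic_eqI:
  assumes f: "f nicely_meromorphic_on UNIV" and g: "g nicely_meromorphic_on UNIV"
    and eq: "eventually (\<lambda>z. f z = g z) (at z0)"
  shows "f = g"
proof
  fix z
  define h where "h w = f w - g w" for w
  have h: "h meromorphic_on UNIV"
    unfolding h_def using f g by (intro meromorphic_intros) (auto simp: nicely_meromorphic_on_def)
  have sing: "isolated_singularity_at h w" for w
    using h by (simp add: meromorphic_on_isolated_singularity meromorphic_on_subset)
  have rh: "remove_sings h nicely_meromorphic_on UNIV" by (rule remove_sings_nicely_meromorphic[OF h])
  have "eventually (\<lambda>w. remove_sings h w = 0) (at z0)"
    using eventually_remove_sings_eq_at[OF sing, of z0] eq by eventually_elim (simp add: h_def)
  hence "frequently (\<lambda>w. remove_sings h w = 0) (at z0)"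
    by (rule eventually_frequently[rotated]) simp
  from frequently_eq_meromorphic_imp_constant[OF this rh] have "remove_sings h w = 0" for w
    by (simp add: connected_UNIV)
  with eventually_remove_sings_eq_at[OF sing, of z] have "eventually (\<lambda>w. f w = g w) (at z)"
    by (auto simp: h_def elim: eventually_mono)
  from remove_sings_cong[OF this refl] show "f z = g z"
    by (simp add: nicely_meromorphic_remove_sings f g)
qed

lemma neumann_zeta_eq:
  fixes q :: "real ^ 'n"
  assumes q: "\<And>j. q $ j > 0"
  shows "neumann_zeta q = remove_sings (box_zeta q)"
  unfolding neumann_zeta_def
proof (rule the_equality)
  have eq: "remove_sings (box_zeta q) s = neumann_zeta_series q s" if s: "Re s > real CARD('n) / 2" for s
  proof -
    have "box_zeta q analytic_on {s}"
    proof (rule box_zeta_analytic[OF q])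
      fix d assume d: "d \<le> CARD('n)"
      show "s \<noteq> of_real (real d / 2)"
      proof
        assume "s = of_real (real d / 2)"
        hence "Re s = real d / 2" by (simp only: Re_complex_of_real)
        with s d show False by simp
      qed
    qed
    thus ?thesis by (simp add: box_zeta_eq_series[OF q s])
  qed
  have nice: "remove_sings (box_zeta q) nicely_meromorphic_on UNIV"
    by (rule remove_sings_nicely_meromorphic[OF box_zeta_meromorphic[OF q]])
  show "remove_sings (box_zeta q) nicely_meromorphic_on UNIV \<and>
     (\<forall>s. Re s > real CARD('n) / 2 \<longrightarrow> remove_sings (box_zeta q) s = neumann_zeta_series q s)"
    using nice eq by blast
  fix Z assume Z: "Z nicely_meromorphic_on UNIV \<and>
     (\<forall>s. Re s > real CARD('n) / 2 \<longrightarrow> Z s = neumann_zeta_series q s)"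
  show "Z = remove_sings (box_zeta q)"
  proof (rule nicely_meromorphic_eqI)
    \<comment> \<open>The number \<open>n\<close> serves as base point, since it lies in the
      half-plane of real part above \<open>n / 2\<close>.\<close>
    have "open {s. Re s > real CARD('n) / 2}" by (rule open_halfspace_Re_gt)
    hence "eventually (\<lambda>s. s \<in> {s. Re s > real CARD('n) / 2}) (at (of_nat CARD('n)))"
      by (intro eventually_at_in_open') auto
    thus "eventually (\<lambda>s. Z s = remove_sings (box_zeta q) s) (at (of_nat CARD('n)))"
      by eventually_elim (use Z eq in auto)
  qed (use Z nice in auto)
qed

subsection \<open>The derivative at zero and the comparison with the cube\<close>

text \<open>By symmetry every \<open>ln (q $ j)\<close> has the same total coefficient.\<close>

lemma sum_box_shift:
  fixes q :: "real ^ 'n"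
  assumes q: "\<And>j. q $ j > 0" and vol: "(\<Prod>j\<in>UNIV. q $ j) = 1"
  shows "(\<Sum>S\<in>Pow UNIV - {{}}. box_shift q S) = 0"
proof -
  define \<kappa> where "\<kappa> j = (\<Sum>S | j \<in> S. 2 / real (card S))" for j :: 'n
  have \<kappa>: "\<kappa> i = \<kappa> j" for i j
    unfolding \<kappa>_def
  proof (rule sum.reindex_bij_witness[of _ "(`) (Transposition.transpose i j)" "(`) (Transposition.transpose i j)"])
    fix S assume "S \<in> {S. i \<in> S}"
    thus "Transposition.transpose i j ` S \<in> {S. j \<in> S}" by (auto intro: image_eqI[of _ _ i])
  next
    fix S assume "S \<in> {S. j \<in> S}"
    thus "Transposition.transpose i j ` S \<in> {S. i \<in> S}" by (auto intro: image_eqI[of _ _ j])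
  qed (auto simp: image_image card_image)
  have "(\<Sum>S\<in>Pow UNIV - {{}}. box_shift q S) = (\<Sum>S\<in>UNIV. \<Sum>j\<in>UNIV. if j \<in> S then 2 / real (card S) * ln (q $ j) else 0)"
    by (rule sum.mono_neutral_cong_left) (auto simp: box_shift_def sum_distrib_left sum.If_cases)
  also have "\<dots> = (\<Sum>j\<in>UNIV. \<Sum>S\<in>UNIV. if j \<in> S then 2 / real (card S) * ln (q $ j) else 0)"
    by (rule sum.swap)
  also have "\<dots> = (\<Sum>j\<in>UNIV. \<kappa> j * ln (q $ j))"
    by (simp add: \<kappa>_def sum_distrib_right sum.If_cases)
  also have "\<dots> = (\<Sum>j\<in>UNIV. \<kappa> undefined * ln (q $ j))"
    by (intro sum.cong refl arg_cong2[of _ _ _ _ "(*)"] \<kappa>)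
  also have "\<dots> = \<kappa> undefined * (\<Sum>j\<in>UNIV. ln (q $ j))" by (simp add: sum_distrib_left)
  also have "(\<Sum>j\<in>UNIV. ln (q $ j)) = ln (\<Prod>j\<in>UNIV. q $ j)"
    by (rule ln_prod[symmetric]) (use q less_imp_neq in \<open>auto simp: less_le\<close>)
  also have "\<dots> = 0" by (simp add: vol)
  finally show ?thesis by simp
qed

section \<open>Monotonicity of real Laplace transforms\<close>

definition laplace_real :: "(real \<Rightarrow> real) \<Rightarrow> real \<Rightarrow> real" where
  "laplace_real w a = (LINT u:{0<..}|lborel. exp (a * u) * w u)"

lemma laplace_of_real: "laplace w (of_real a) = of_real (laplace_real w a)"
proof -
  have "exp (complex_of_real a * of_real u) * of_real (w u) = of_real (exp (a * u) * w u)" for u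
    by (simp add: exp_of_real flip: of_real_mult)
  thus ?thesis unfolding laplace_def laplace_real_def by (simp only: set_integral_complex_of_real)
qed

lemma laplace_real_integrable:
  assumes "rapid w"
  shows "set_integrable lborel {0<..} (\<lambda>u. exp (a * u) * w u)"
proof -
  have "exp (complex_of_real a * of_real u) * of_real (w u) = of_real (exp (a * u) * w u)" for u
    by (simp add: exp_of_real flip: of_real_mult)
  with laplace_integrable[OF assms, of "of_real a"]
  have "set_integrable lborel {0<..} (\<lambda>u. complex_of_real (exp (a * u) * w u))" by simp
  from integrable_Re[OF this[unfolded set_integrable_def]] show ?thesis
    by (simp add: set_integrable_def)
qed

lemma laplace_real_mono:
  assumes "rapid v" "rapid w" "\<And>u. u > 0 \<Longrightarrow> v u \<le> w u"
  shows "laplace_real v a \<le> laplace_real w a"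
  unfolding laplace_real_def
  by (intro set_integral_mono laplace_real_integrable assms mult_left_mono) (use assms(3) in auto)

text \<open>If the two integrals agreed, a nonnegative function with integral zero would vanish
  almost everywhere, although it is positive on \<open>{0<..<1}\<close>.\<close>

lemma laplace_real_strict_mono:
  assumes v: "rapid v" and w: "rapid w" and less: "\<And>u. u > 0 \<Longrightarrow> v u < w u"
  shows "laplace_real v a < laplace_real w a"
proof (rule ccontr)
  let ?g = "\<lambda>u. indicator {0<..} u *\<^sub>R (exp (a * u) * (w u - v u))"
  assume "\<not> ?thesis"
  moreover have "laplace_real v a \<le> laplace_real w a"
    by (rule laplace_real_mono[OF v w]) (use less in \<open>auto intro: less_imp_le\<close>)
  ultimately have eq: "laplace_real v a = laplace_real w a" by simp
  note i = laplace_real_integrable[OF v, of a] laplace_real_integrable[OF w, of a]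
  have g: "integrable lborel ?g"
    using set_integral_diff(1)[OF i(2) i(1)] by (simp add: set_integrable_def algebra_simps)
  have "(\<integral>u. ?g u \<partial>lborel) = 0"
    using set_integral_diff(2)[OF i(2) i(1)] eq
    by (simp add: set_lebesgue_integral_def laplace_real_def algebra_simps)
  moreover have "AE u in lborel. 0 \<le> ?g u"
    using less by (intro AE_I2) (auto simp: indicator_def less_imp_le)
  ultimately have "AE u in lborel. ?g u = 0"
    using integral_nonneg_eq_0_iff_AE[OF g] by blast
  hence "AE u in lborel. u \<notin> {0<..<1::real}"
    by eventually_elim (use less in \<open>force simp: indicator_def\<close>)
  hence "{0<..<1::real} \<in> null_sets lborel"
    by (subst (asm) AE_iff_null_sets[symmetric]) auto
  thus False by (auto simp: null_sets_def)
qed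

definition box_energy :: "real ^ 'n \<Rightarrow> 'n set \<Rightarrow> real" where
  "box_energy q S = laplace_real (\<lambda>u. theta_prod S (box_ratio q S) u - 1) 0 +
     laplace_real (\<lambda>u. theta_prod S (\<lambda>j. 1 / box_ratio q S j) u - 1) (real (card S) / 2)"

lemma box_regular_0: "box_regular q S 0 = of_real (box_energy q S)"
  using laplace_of_real[of _ 0] laplace_of_real[of _ "real (card S) / 2"]
  by (simp add: box_regular_def box_energy_def)

text \<open>Contributions at \<open>s = 0\<close>, per set \<open>S\<close>: \<open>ln pi\<close>
  from differentiating \<open>pi powr (- s)\<close> against the value \<open>- 1\<close>,
  \<open>- 2 / card S\<close> from the fraction with pole at \<open>card S / 2\<close>, and Euler's
  constant from the derivative of \<open>rGamma\<close> at 1.\<close>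

definition box_const :: "'n itself \<Rightarrow> real" where
  "box_const _ = 1 / 2 ^ CARD('n) * (\<Sum>S\<in>Pow (UNIV :: 'n set) - {{}}. ln pi - 2 / real (card S) - euler_mascheroni)"

text \<open>As \<open>rGamma\<close> vanishes at 0 with derivative 1, the product
  \<open>rGamma s * H s\<close> has derivative \<open>H 0\<close>, whatever \<open>H\<close> does to
  first order. The exponential factor meets the value \<open>- 1\<close> of its cofactor and
  contributes \<open>- box_shift q S\<close>, which sums to zero by the volume condition.\<close>

lemma box_zeta_deriv_0:
  fixes q :: "real ^ 'n"
  assumes q: "\<And>j. q $ j > 0" and vol: "(\<Prod>j\<in>UNIV. q $ j) = 1"
  shows "deriv (box_zeta q) 0 =
    of_real (box_const TYPE('n) + 1 / 2 ^ CARD('n) * (\<Sum>S\<in>Pow UNIV - {{}}. box_energy q S))"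
proof -
  let ?I = "Pow (UNIV :: 'n set) - {{}}"
  have rG0: "(rGamma has_field_derivative 1) (at (0 :: complex))"
    using has_field_derivative_rGamma_nonpos_int[of 0, where ?'a = complex] by simp
  have rG1: "((\<lambda>s. rGamma (s + 1)) has_field_derivative euler_mascheroni) (at (0 :: complex))"
  proof -
    have "(rGamma has_field_derivative euler_mascheroni) (at (0 + 1 :: complex))"
      using has_field_derivative_rGamma_no_nonpos_int[of "1 :: complex"] by simp
    thus ?thesis by (subst (asm) DERIV_shift) simp
  qed
  have summand: "((\<lambda>s. exp (s * of_real (box_shift q S)) *
        (rGamma s * (box_regular q S s + 1 / (s - of_real (real (card S) / 2))) - rGamma (s + 1)))
      has_field_derivative of_real (box_energy q S - box_shift q S - 2 / real (card S) - euler_mascheroni)) (at 0)"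
    if S: "S \<in> ?I" for S
  proof -
    define H where "H s = box_regular q S s + 1 / (s - of_real (real (card S) / 2))" for s
    have c: "real (card S) \<noteq> 0" using S by (simp add: card_gt_0_iff)
    have "z - of_real (real (card S) / 2) \<noteq> 0" if "z \<in> ball 0 (real (card S) / 2)" for z :: complex
    proof
      assume "z - of_real (real (card S) / 2) = 0"
      hence "z = of_real (real (card S) / 2)" by (simp only: right_minus_eq)
      with that show False by simp
    qed
    hence "H holomorphic_on ball 0 (real (card S) / 2)"
      unfolding H_def by (intro holomorphic_intros box_regular_holomorphic q)
    hence "H field_differentiable at 0"
      by (rule holomorphic_on_imp_differentiable_at) (use c in auto)
    then obtain H' where H': "(H has_field_derivative H') (at 0)" by (auto simp: field_differentiable_def)
    have H0: "H 0 = of_real (box_energy q S - 2 / real (card S))"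
      by (simp add: H_def box_regular_0)
    have "((\<lambda>s. exp (s * of_real (box_shift q S)) * (rGamma s * H s - rGamma (s + 1))) has_field_derivative
        of_real (box_shift q S) * (rGamma 0 * H 0 - rGamma (0 + 1)) + (1 * H 0 + H' * rGamma 0 - euler_mascheroni) * 1) (at 0)"
      by (rule derivative_eq_intros rG0 rG1 H' refl | simp)+
    moreover have "of_real (box_shift q S) * (rGamma 0 * H 0 - rGamma (0 + 1)) + (1 * H 0 + H' * rGamma 0 - euler_mascheroni) * 1 =
        complex_of_real (box_energy q S - box_shift q S - 2 / real (card S) - euler_mascheroni)"
      by (simp add: H0)
    ultimately show ?thesis unfolding H_def by (simp only:)
  qed
  define g where "g s = (\<Sum>S\<in>?I. exp (s * of_real (box_shift q S)) *
        (rGamma s * (box_regular q S s + 1 / (s - of_real (real (card S) / 2))) - rGamma (s + 1)))" for s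
  define g' where "g' = (\<Sum>S\<in>?I. box_energy q S - box_shift q S - 2 / real (card S) - euler_mascheroni)"
  have g: "(g has_field_derivative of_real g') (at 0)"
    unfolding g_def[abs_def] g'_def of_real_sum by (rule DERIV_sum[OF summand])
  define N where "N = (\<Sum>S\<in>?I. 1 :: real)"
  have g0: "g 0 = of_real (- N)" by (simp add: g_def N_def)
  have N: "(\<Sum>S\<in>?I. ln pi) = N * ln pi" by (simp only: N_def sum_distrib_right mult_1_left)
  have "((\<lambda>s. complex_of_real pi powr (- s)) has_field_derivative - of_real (ln pi)) (at 0)"
  proof -
    have "(\<lambda>s. complex_of_real pi powr (- s)) = (\<lambda>s. exp (- s * of_real (ln pi)))"
      by (simp add: powr_def Ln_of_real)
    thus ?thesis by (auto intro!: derivative_eq_intros)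
  qed
  hence "(box_zeta q has_field_derivative
      - of_real (ln pi) * ((1 / 2 ^ CARD('n)) * g 0) + (1 / 2 ^ CARD('n) * of_real g') * (complex_of_real pi powr (- 0))) (at 0)"
    unfolding box_zeta_def[abs_def] g_def[symmetric]
    by (intro DERIV_mult DERIV_cmult g)
  hence "deriv (box_zeta q) 0 = - of_real (ln pi) * ((1 / 2 ^ CARD('n)) * g 0) + (1 / 2 ^ CARD('n) * of_real g') * (complex_of_real pi powr (- 0))"
    by (rule DERIV_imp_deriv)
  also have "\<dots> = of_real (1 / 2 ^ CARD('n) * ((\<Sum>S\<in>?I. ln pi) + g'))"
    unfolding g0 N by (simp add: algebra_simps add_divide_distrib)
  also have "g' = (\<Sum>S\<in>?I. - 2 / real (card S) - euler_mascheroni) + (\<Sum>S\<in>?I. box_energy q S)"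
  proof -
    have "g' = (\<Sum>S\<in>?I. - 2 / real (card S) - euler_mascheroni) + (\<Sum>S\<in>?I. box_energy q S) - (\<Sum>S\<in>?I. box_shift q S)"
      unfolding g'_def by (simp add: sum.distrib[symmetric] sum_subtractf[symmetric] algebra_simps)
    thus ?thesis using sum_box_shift[OF q vol] by simp
  qed
  also have "1 / 2 ^ CARD('n) * ((\<Sum>S\<in>?I. ln pi) + ((\<Sum>S\<in>?I. - 2 / real (card S) - euler_mascheroni) + (\<Sum>S\<in>?I. box_energy q S))) =
      box_const TYPE('n) + 1 / 2 ^ CARD('n) * (\<Sum>S\<in>?I. box_energy q S)"
  proof -
    have "(\<Sum>S\<in>?I. ln pi - 2 / real (card S) - euler_mascheroni) =
        (\<Sum>S\<in>?I. ln pi) + (\<Sum>S\<in>?I. - 2 / real (card S) - euler_mascheroni)"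
      unfolding sum.distrib[symmetric] by (intro sum.cong) simp_all
    thus ?thesis unfolding box_const_def by (simp only: distrib_left add.assoc)
  qed
  finally show ?thesis .
qed

lemma neumann_det_eq:
  fixes q :: "real ^ 'n"
  assumes "unit_volume_box q"
  shows "neumann_det q =
    exp (- (box_const TYPE('n) + 1 / 2 ^ CARD('n) * (\<Sum>S\<in>Pow UNIV - {{}}. box_energy q S)))"
proof -
  have q: "q $ j > 0" for j using assms by (simp add: unit_volume_box_def)
  have vol: "(\<Prod>j\<in>UNIV. q $ j) = 1" using assms by (simp add: unit_volume_box_def)
  \<comment> \<open>Analyticity at 0 means that \<open>remove_sings\<close> changes nothing near 0,
    so the derivatives agree.\<close>
  have "box_zeta q analytic_on {0}" by (rule box_zeta_analytic[OF q]) auto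
  hence "deriv (neumann_zeta q) 0 = deriv (box_zeta q) 0" by (simp add: neumann_zeta_eq[OF q])
  thus ?thesis unfolding neumann_det_def box_zeta_deriv_0[OF q vol]
    by (simp only: of_real_minus[symmetric] exp_of_real Re_complex_of_real)
qed

section \<open>Comparison with the cube, one torus at a time\<close>

lemma box_energy_cube_le:
  fixes q :: "real ^ 'n"
  assumes q: "\<And>j. q $ j > 0" and S: "S \<noteq> {}"
  shows "box_energy (\<chi> j. 1) S \<le> box_energy q S"
    and "\<exists>j\<in>S. box_ratio q S j \<noteq> 1 \<Longrightarrow> box_energy (\<chi> j. 1) S < box_energy q S"
proof -
  let ?e = "(\<chi> j. 1) :: real ^ 'n"
  have r1: "box_ratio ?e S j = 1" for j by (simp add: box_ratio_def box_shift_def)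
  have e: "theta_prod S (box_ratio ?e S) u = jtheta (exp u) ^ card S"
    "theta_prod S (\<lambda>j. 1 / box_ratio ?e S j) u = jtheta (exp u) ^ card S" for u
    by (simp_all add: theta_prod_def r1)
  have c: "box_ratio q S j > 0" for j using q by (rule box_ratio_pos)
  have c1: "prod (box_ratio q S) S = 1" by (rule box_ratio_prod[OF q S])
  \<comment> \<open>The reciprocals have product one too, so Jensen's inequality also covers the
    dual torus.\<close>
  have c1': "(\<Prod>j\<in>S. 1 / box_ratio q S j) = 1" using c1 by (simp add: prod_dividef)
  have rap: "rapid (\<lambda>u. theta_prod S b u - 1)" if "\<And>j. b j > 0" for b :: "'n \<Rightarrow> real"
    by (intro rapid_theta_prod that) simp
  have rapids: "rapid (\<lambda>u. theta_prod S (box_ratio q S) u - 1)" "rapid (\<lambda>u. theta_prod S (\<lambda>j. 1 / box_ratio q S j) u - 1)"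
    "rapid (\<lambda>u. theta_prod S (box_ratio ?e S) u - 1)" "rapid (\<lambda>u. theta_prod S (\<lambda>j. 1 / box_ratio ?e S j) u - 1)"
    by (rule rap; simp add: c r1)+
  have second: "laplace_real (\<lambda>u. theta_prod S (\<lambda>j. 1 / box_ratio ?e S j) u - 1) (real (card S) / 2) \<le>
      laplace_real (\<lambda>u. theta_prod S (\<lambda>j. 1 / box_ratio q S j) u - 1) (real (card S) / 2)"
  proof (rule laplace_real_mono[OF rapids(4,2)])
    show "theta_prod S (\<lambda>j. 1 / box_ratio ?e S j) u - 1 \<le> theta_prod S (\<lambda>j. 1 / box_ratio q S j) u - 1" for u
      unfolding e using prod_jtheta_ge[of S "\<lambda>j. 1 / box_ratio q S j" "exp u"] c c1' by (simp add: theta_prod_def)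
  qed
  have first: "laplace_real (\<lambda>u. theta_prod S (box_ratio ?e S) u - 1) 0 \<le>
      laplace_real (\<lambda>u. theta_prod S (box_ratio q S) u - 1) 0"
  proof (rule laplace_real_mono[OF rapids(3,1)])
    show "theta_prod S (box_ratio ?e S) u - 1 \<le> theta_prod S (box_ratio q S) u - 1" for u
      unfolding e using prod_jtheta_ge[of S "box_ratio q S" "exp u"] c c1 by (simp add: theta_prod_def)
  qed
  show "box_energy ?e S \<le> box_energy q S" using first second by (simp add: box_energy_def)
  assume ne: "\<exists>j\<in>S. box_ratio q S j \<noteq> 1"
  have "laplace_real (\<lambda>u. theta_prod S (box_ratio ?e S) u - 1) 0 <
      laplace_real (\<lambda>u. theta_prod S (box_ratio q S) u - 1) 0"
  proof (rule laplace_real_strict_mono[OF rapids(3,1)])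
    show "theta_prod S (box_ratio ?e S) u - 1 < theta_prod S (box_ratio q S) u - 1" for u
      unfolding e using prod_jtheta_gt[of S "box_ratio q S" "exp u"] c c1 ne by (simp add: theta_prod_def)
  qed
  thus "box_energy ?e S < box_energy q S" using second by (simp add: box_energy_def)
qed

text \<open>Strictness comes from the full set of coordinates: volume one makes its shift zero, its
  ratios are the \<open>1 / (q $ j)^2\<close>, and one of them differs from 1 as soon as a side
  does.\<close>

lemma neumann_det_less_cube:
  fixes q :: "real ^ 'n"
  assumes box: "unit_volume_box q" and ne: "q \<noteq> (\<chi> j. 1)"
  shows "neumann_det q < neumann_det ((\<chi> j. 1) :: real ^ 'n)"
proof -
  let ?e = "(\<chi> j. 1) :: real ^ 'n"
  have q: "q $ j > 0" for j using box by (simp add: unit_volume_box_def)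
  have vol: "(\<Prod>j\<in>UNIV. q $ j) = 1" using box by (simp add: unit_volume_box_def)
  have e: "unit_volume_box ?e" by (simp add: unit_volume_box_def)
  have "(\<Sum>j\<in>UNIV. ln (q $ j)) = ln (\<Prod>j\<in>UNIV. q $ j)"
    by (rule ln_prod[symmetric]) (use q less_imp_neq in \<open>auto simp: less_le\<close>)
  hence "box_shift q UNIV = 0" by (simp add: box_shift_def vol)
  moreover obtain i where "q $ i \<noteq> 1" using ne by (auto simp: vec_eq_iff)
  ultimately have "box_ratio q UNIV i \<noteq> 1" using q[of i]
    by (auto simp: box_ratio_def power2_eq_1_iff)
  hence "(\<Sum>S\<in>Pow UNIV - {{}}. box_energy ?e S) < (\<Sum>S\<in>Pow UNIV - {{}}. box_energy q S)"
    by (intro sum_strict_mono_ex1 ballI box_energy_cube_le(1)[OF q] bexI[of _ UNIV] box_energy_cube_le(2)[OF q]) auto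
  thus ?thesis by (simp add: neumann_det_eq box e divide_strict_right_mono)
qed

theorem theorem4p3:
  fixes q :: "real ^ 'n"
  assumes "CARD('n) \<ge> 2"
  shows "is_arg_max neumann_det unit_volume_box q \<longleftrightarrow> q = (\<chi> j. 1)"
proof -
  have e: "unit_volume_box ((\<chi> j. 1) :: real ^ 'n)" by (simp add: unit_volume_box_def)
  show ?thesis
    unfolding is_arg_max_def using e neumann_det_less_cube by (metis less_asym)
qed

end
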